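(* Let $X_1,\dots,X_N\subset\mathbb{R}^d$ be convex, compact subsets with nonempty interior and $X=X_1\times\dots\times X_N$. Suppose $f_1,\dots,f_N:X\to\mathbb{R}$ are $N$-linear, in the sense that for each $j=1,\dots,N$ and each $x\in X$ the function $X_j\ni y_j\mapsto f_j(y_j,x_{-j})$ is linear, and suppose that $$\sum_{j=1}^N\bigl(f_j(x)+f_j(y)\bigr)\ge\sum_{j=1}^N\bigl(f_j(y_j,x_{-j})+f_j(x_j,y_{-j})\bigr)\quad\text{for all }x,y\in X.$$ Then for each $u^0\in X$ there is a unique Lipschitz $u:[0,\infty)\to X$ such that $$u(0)=u^0,\qquad \sum_{j=1}^N(\dot u_j(t)+\nabla_{x_j}f_j(u(t)))\cdot(y_j-u_j(t))\ge0\ \text{ for a.e. }t\ge0\text{ and all }y\in X.$$ Moreover, $\frac1t\int_0^tu(s)\,ds$ converges as $t\to\infty$ to a Nash equilibrium of $f_1,\dots,f_N$.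
   Context: For $x=(x_1,\dots,x_N)\in X$ and $y_j\in X_j$, $(y_j,x_{-j})$ is the point of $X$ obtained from $x$ by replacing the $j$-th coordinate $x_j$ by $y_j$. Linearity of $y_j\mapsto f_j(y_j,x_{-j})$ on $X_j$ means that it is the restriction to $X_j$ of a linear function on $\mathbb{R}^d$; thus $\nabla_{x_j}f_j(x)\in\mathbb{R}^d$, the gradient of $f_j$ in its $j$-th variable, satisfies $y_j\cdot\nabla_{x_j}f_j(x)=f_j(y_j,x_{-j})$ for all $y_j\in X_j$ and $x\in X$. Here $\cdot$ is the Euclidean dot product, and $u(t)=(u_1(t),\dots,u_N(t))$. A Nash equilibrium of $f_1,\dots,f_N$ is a point $x\in X$ with $f_j(x)\le f_j(y_j,x_{-j})$ for all $y_j\in X_j$ and all $j=1,\dots,N$. *)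

theory Defs
  imports "HOL-Analysis.Analysis"
begin

text \<open>
  The index type \<open>'n\<close> plays the role of \<open>{1..N}\<close>, so a point \<open>x = (x\<^sub>1, \<dots>, x\<^sub>N)\<close> has
  type \<open>(real ^ 'd) ^ 'n\<close> with \<open>x $ j \<in> \<real>\<^sup>d\<close>.  The functions \<open>f j\<close> are total; only their values on the
  product set matter.
\<close>

definition vprod :: "('n \<Rightarrow> (real ^ 'd) set) \<Rightarrow> ((real ^ 'd) ^ 'n) set" where
  "vprod X = {x. \<forall>j. x $ j \<in> X j}"

definition replace :: "(real ^ 'd) ^ 'n \<Rightarrow> 'n \<Rightarrow> real ^ 'd \<Rightarrow> (real ^ 'd) ^ 'n" where
  "replace x j z = (\<chi> i. if i = j then z else x $ i)"

definition N_linear ::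
    "('n \<Rightarrow> (real ^ 'd) set) \<Rightarrow> ('n \<Rightarrow> (real ^ 'd) ^ 'n \<Rightarrow> real) \<Rightarrow> bool" where
  "N_linear X f \<longleftrightarrow>
     (\<forall>j. \<forall>x\<in>vprod X. \<exists>l. linear l \<and> (\<forall>z\<in>X j. f j (replace x j z) = l z))"

text \<open>
  The derivative is taken within \<open>X j\<close> because \<open>x $ j\<close> may be a boundary point.  It is
  unique there when \<open>X j\<close> is convex with nonempty interior, see \<open>partial_gradient_inner\<close>.
\<close>

definition partial_gradient ::
    "('n \<Rightarrow> (real ^ 'd) set) \<Rightarrow> ('n \<Rightarrow> (real ^ 'd) ^ 'n \<Rightarrow> real) \<Rightarrow> 'n \<Rightarrow> (real ^ 'd) ^ 'n \<Rightarrow> real ^ 'd" where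
  "partial_gradient X f j x =
     (THE g. ((\<lambda>z. f j (replace x j z)) has_derivative (\<lambda>h. g \<bullet> h)) (at (x $ j) within X j))"

definition nash_equilibrium ::
    "('n \<Rightarrow> (real ^ 'd) set) \<Rightarrow> ('n \<Rightarrow> (real ^ 'd) ^ 'n \<Rightarrow> real) \<Rightarrow> (real ^ 'd) ^ 'n \<Rightarrow> bool" where
  "nash_equilibrium X f x \<longleftrightarrow>
     x \<in> vprod X \<and> (\<forall>j. \<forall>z\<in>X j. f j x \<le> f j (replace x j z))"

text \<open>
  A path on \<open>[0,\<infinity>)\<close> is represented by a total function whose values at negative times are
  irrelevant; hence the one-sided derivative at \<open>0\<close> and the restriction to \<open>t \<ge> 0\<close>.
\<close>

definition lipschitz_solution ::
    "('n \<Rightarrow> (real ^ 'd) set) \<Rightarrow> ('n \<Rightarrow> (real ^ 'd) ^ 'n \<Rightarrow> real) \<Rightarrow> (real ^ 'd) ^ 'n \<Rightarrow>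
     (real \<Rightarrow> (real ^ 'd) ^ 'n) \<Rightarrow> bool" where
  "lipschitz_solution X f u0 u \<longleftrightarrow>
     (\<forall>t\<ge>0. u t \<in> vprod X) \<and>
     (\<exists>L. L-lipschitz_on {0..} u) \<and>
     u 0 = u0 \<and>
     (AE t in lebesgue. 0 \<le> t \<longrightarrow>
        (\<exists>v. (u has_vector_derivative v) (at t within {0..}) \<and>
             (\<forall>y\<in>vprod X.
                (\<Sum>j\<in>UNIV. (v $ j + partial_gradient X f j (u t)) \<bullet> (y $ j - u t $ j)) \<ge> 0)))"

lemma partial_gradient_inner:
  assumes "convex (X j)" "interior (X j) \<noteq> {}" "N_linear X f"
    and x: "x \<in> vprod X" and z: "z \<in> X j"
  shows "z \<bullet> partial_gradient X f j x = f j (replace x j z)"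
proof -
  obtain l where l: "linear l" "\<And>z. z \<in> X j \<Longrightarrow> f j (replace x j z) = l z"
    using assms(3) x unfolding N_linear_def by blast
  define a where "a = (\<Sum>b\<in>Basis. l b *\<^sub>R b)"
  have la: "l w = a \<bullet> w" for w
  proof -
    have "l w = l (\<Sum>b\<in>Basis. (w \<bullet> b) *\<^sub>R b)" by (simp add: euclidean_representation)
    also have "\<dots> = (\<Sum>b\<in>Basis. (w \<bullet> b) * l b)"
      by (simp add: linear_sum[OF l(1)] linear_cmul[OF l(1)])
    also have "\<dots> = a \<bullet> w"
      by (simp add: a_def inner_sum_left inner_commute[of w] mult.commute)
    finally show ?thesis .
  qed
  let ?F = "\<lambda>z. f j (replace x j z)"
  have xj: "x $ j \<in> X j" using x by (simp add: vprod_def)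
  have lin: "((\<lambda>z. a \<bullet> z) has_derivative (\<lambda>h. a \<bullet> h)) (at (x $ j) within X j)"
    by (intro derivative_eq_intros) auto
  have der: "(?F has_derivative (\<lambda>h. a \<bullet> h)) (at (x $ j) within X j)"
    by (rule has_derivative_transform[OF xj _ lin]) (simp add: l la)
  have uniq: "g = a" if g: "(?F has_derivative (\<lambda>h. g \<bullet> h)) (at (x $ j) within X j)" for g
  proof -
    have eq: "(g - a) \<bullet> (w - x $ j) = 0" if w: "w \<in> X j" for w
    proof -
      let ?p = "\<lambda>s. x $ j + s *\<^sub>R (w - x $ j)"
      have p: "?p ` {0..1} \<subseteq> X j"
      proof safe
        fix s :: real assume "s \<in> {0..1}"
        then show "?p s \<in> X j"
          using convexD_alt[OF assms(1) xj w, of s] by (simp add: algebra_simps)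
      qed
      have dp: "(?p has_derivative (\<lambda>s. s *\<^sub>R (w - x $ j))) (at 0 within {0..1})"
        by (auto intro!: derivative_eq_intros)
      have c: "((\<lambda>s. ?F (?p s)) has_derivative (\<lambda>s. b \<bullet> (s *\<^sub>R (w - x $ j)))) (at 0 within {0..1})"
        if "(?F has_derivative (\<lambda>h. b \<bullet> h)) (at (x $ j) within X j)" for b
        by (rule has_derivative_in_compose[OF dp]) (use has_derivative_subset[OF that p] in simp)
      have cv: "((\<lambda>s. ?F (?p s)) has_vector_derivative b \<bullet> (w - x $ j)) (at 0 within cbox 0 1)"
        if "(?F has_derivative (\<lambda>h. b \<bullet> h)) (at (x $ j) within X j)" for b
        using c[OF that] by (simp add: has_vector_derivative_def)
      have "g \<bullet> (w - x $ j) = a \<bullet> (w - x $ j)"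
        by (rule vector_derivative_unique_within_closed_interval[OF _ _ cv[OF g] cv[OF der]]) auto
      then show ?thesis by (simp add: inner_diff_left)
    qed
    obtain c r where r: "r > 0" "ball c r \<subseteq> X j"
      using assms(2) by (metis all_not_in_conv mem_interior)
    let ?w = "c + (r / 2 / (norm (g - a) + 1)) *\<^sub>R (g - a)"
    have n1: "norm (g - a) + 1 > 0" by (rule add_nonneg_pos) auto
    have less: "r / 2 / (n + 1) * n < r" if "n \<ge> 0" for n :: real
    proof -
      have "0 < r * n + 2 * r" using r(1) that by (intro add_nonneg_pos) simp_all
      then show ?thesis using that by (simp add: field_simps)
    qed
    have "norm ((r / 2 / (norm (g - a) + 1)) *\<^sub>R (g - a)) = r / 2 / (norm (g - a) + 1) * norm (g - a)"
      using r(1) n1 by simp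
    with less[OF norm_ge_zero[of "g - a"]] have "?w \<in> ball c r"
      using r(1) by (simp add: dist_norm)
    then have "?w \<in> X j" using r(2) by blast
    moreover have "c \<in> X j" using r by auto
    ultimately have "(g - a) \<bullet> (?w - c) = 0"
      using eq[of ?w] eq[of c] by (simp add: inner_diff_right inner_add_right)
    then have "(r / 2 / (norm (g - a) + 1)) * ((g - a) \<bullet> (g - a)) = 0"
      by simp
    then show "g = a" using r n1 by auto
  qed
  have "partial_gradient X f j x = a"
    unfolding partial_gradient_def by (rule the_equality[where P = "\<lambda>g. (?F has_derivative (\<lambda>h. g \<bullet> h)) (at (x $ j) within X j)", OF der uniq])
  then show ?thesis using l(2)[OF z] la by (simp add: inner_commute)
qed

end

theory Submission
  imports Defs
begin

text \<open>
  Write \<open>A x\<close> for the tuple of partial gradients at \<open>x\<close> and \<open>K\<close> for the product of the \<open>X j\<close>.  The evolution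
  is the differential inclusion \<open>u' + A u + N\<^sub>K u \<ni> 0\<close>, where \<open>N\<^sub>K\<close> is the normal cone of \<open>K\<close>, and \<open>x\<close> is a Nash
  equilibrium as soon as \<open>A x \<bullet> (y - x) \<ge> 0\<close> on \<open>K\<close>.  The theorem is the theory of monotone
  evolutions once \<open>A\<close> is known to be monotone and Lipschitz.

  Monotonicity is the assumed inequality.  Lipschitz continuity is hidden, since \<open>f j\<close> is only assumed
  regular in its own variable.  It comes from a symmetry: summed over all ways of swapping some of the
  coordinates of \<open>x\<close> and \<open>y\<close>, the inequality becomes \<open>0 \<ge> 0\<close>, so that it is always an equality
  (\<open>exchange_inequality_imp_equality\<close>).  Hence \<open>(A x - A y) \<bullet> (x - y) = 0\<close>, and a map with this property
  on a set with interior points is Lipschitz (\<open>skew_map_lipschitz\<close>).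

  Existence: the projected Euler scheme solves the inclusion up to an error proportional to the step
  size, and monotonicity makes any two approximate solutions stay close
  (\<open>eps_solution_contraction\<close>), so the Euler paths converge.  The limit is Lipschitz, but its almost
  everywhere differentiability is obtained without Rademacher's theorem.  Every cluster point of its
  difference quotients is the negative of an element of \<open>A + N\<^sub>K\<close>; comparing with constant paths bounds its norm by the
  smallest norm of such an element, and this element is unique, so the right derivative exists everywhere
  (\<open>evolution_right_derivative\<close>).  Its norm decreases in time by contraction, and
  at the points where it is continuous, which are all but countably many, the left derivative is the same
  (\<open>evolution_AE_derivative\<close>).

  Uniqueness is the contraction estimate with zero error.

  Averages: integrating \<open>d/dt |u - y|\<^sup>2 \<le> 2 A y \<bullet> (y - u)\<close> shows that cluster points \<open>p\<close> of the time
  averages satisfy \<open>A y \<bullet> (y - p) \<ge> 0\<close>, which is Minty's form of the equilibrium condition.  Since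
  \<open>|u - p|\<close> decreases for each equilibrium \<open>p\<close>, Opial's argument leaves only one cluster point
  (\<open>solution_average_tendsto_equilibrium\<close>).
\<close>

section \<open>One-sided derivatives, cluster points and averages\<close>

text \<open>
  Zygmund's argument.  If the increment were too large, then after subtracting a linear function every
  value between those at the end points would be left for the last time at a point with no negative
  right derivative.  Such points lie in the exceptional null set, whose Lipschitz image is null and
  therefore misses some of these values.
\<close>

lemma lipschitz_right_derivative_bound:
  fixes g :: "real \<Rightarrow> real"
  assumes lip: "L-lipschitz_on {a..b} g" and "a \<le> b"
    and der: "AE t in lebesgue. a \<le> t \<and> t < b \<longrightarrow>
                (\<exists>d\<le>c. (g has_real_derivative d) (at t within {t..}))"
  shows "g b - g a \<le> c * (b - a)"
proof (rule ccontr)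
  assume "\<not> g b - g a \<le> c * (b - a)"
  then have gt: "c * (b - a) < g b - g a" by simp
  then have "a < b" using \<open>a \<le> b\<close> by (cases "a = b") auto
  obtain c' where c': "c < c'" "c' * (b - a) < g b - g a"
  proof -
    have "c < (g b - g a) / (b - a)" using gt \<open>a < b\<close> by (simp add: field_simps)
    then obtain c' where "c < c'" "c' < (g b - g a) / (b - a)" using dense by blast
    then show ?thesis using that \<open>a < b\<close> by (simp add: field_simps)
  qed
  \<comment> \<open>A slope strictly above \<open>c\<close> makes the right derivatives of \<open>h\<close> strictly negative.\<close>
  define h where "h t = g t - c' * t" for t
  have "h a < h b" using c'(2) by (simp add: h_def algebra_simps)
  define N where "N = {t. a \<le> t \<and> t < b \<and> \<not> (\<exists>d\<le>c. (g has_real_derivative d) (at t within {t..}))}"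
  obtain N' where N': "N' \<in> null_sets lebesgue" "N \<subseteq> N'"
  proof -
    from der obtain N' where "{t \<in> space lebesgue. \<not> (a \<le> t \<and> t < b \<longrightarrow>
        (\<exists>d\<le>c. (g has_real_derivative d) (at t within {t..})))} \<subseteq> N'" "N' \<in> null_sets lebesgue"
      by (auto elim!: AE_E simp: null_sets_def)
    then show ?thesis using that by (auto simp: N_def)
  qed
  have negN: "negligible N"
    using N' negligible_iff_null_sets negligible_subset by blast
  have hlip: "\<bar>h y - h x\<bar> \<le> (L + \<bar>c'\<bar>) * \<bar>y - x\<bar>" if "x \<in> {a..b}" "y \<in> {a..b}" for x y
  proof -
    have "h y - h x = (g y - g x) - c' * (y - x)" by (simp add: h_def algebra_simps)
    then have "\<bar>h y - h x\<bar> \<le> \<bar>g y - g x\<bar> + \<bar>c'\<bar> * \<bar>y - x\<bar>"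
      by (metis abs_mult abs_triangle_ineq4)
    moreover have "\<bar>g y - g x\<bar> \<le> L * \<bar>y - x\<bar>"
      using lipschitz_onD[OF lip that(2,1)] by (simp add: dist_real_def)
    ultimately show ?thesis by (simp add: algebra_simps)
  qed
  have "negligible (h ` N)"
  proof (rule negligible_locally_Lipschitz_image[OF _ negN])
    fix x assume "x \<in> N"
    then show "\<exists>T B. open T \<and> x \<in> T \<and> (\<forall>y\<in>N \<inter> T. norm (h y - h x) \<le> B * norm (y - x))"
      using hlip by (intro exI[of _ UNIV] exI[of _ "L + \<bar>c'\<bar>"]) (auto simp: N_def)
  qed simp
  moreover have "\<not> negligible {h a<..<h b}"
    using \<open>h a < h b\<close> by (metis box_real(1) content_pos_lt_eq greaterThanLessThan_iff negligible_interval(2)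
        box_eq_empty(1) greaterThanLessThan_empty_iff not_le)
  ultimately obtain y where y: "h a < y" "y < h b" "y \<notin> h ` N"
    by (metis greaterThanLessThan_iff negligible_subset subsetI)
  have hcont: "continuous_on {a..b} h"
    unfolding h_def by (intro continuous_intros lipschitz_on_continuous_on[OF lip])
  \<comment> \<open>Its largest element is the last time at which \<open>h\<close> takes the value \<open>y\<close>.\<close>
  define S where "S = {t \<in> {a..b}. h t \<le> y}"
  have "S = {a..b} \<inter> ({a..b} \<inter> h -` {..y})" by (auto simp: S_def)
  moreover have "closed ({a..b} \<inter> h -` {..y})"
    by (rule continuous_closed_preimage[OF hcont closed_atLeastAtMost closed_atMost])
  ultimately have "compact S"
    by (simp only: compact_Int_closed[OF compact_Icc])
  moreover have "a \<in> S" using y \<open>a < b\<close> by (simp add: S_def)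
  ultimately obtain s where s: "s \<in> S" "\<And>t. t \<in> S \<Longrightarrow> t \<le> s"
    using compact_attains_sup[of S] by blast
  have sab: "a \<le> s" "s < b" using s y \<open>a < b\<close> by (auto simp: S_def order.order_iff_strict)
  have above: "y < h t" if "s < t" "t \<le> b" for t
    using s(2)[of t] that sab by (force simp: S_def)
  have "h s = y"
  proof (rule ccontr)
    assume "h s \<noteq> y"
    then have "h s < y" using s by (auto simp: S_def)
    moreover have "continuous_on {s..b} h" using hcont sab by (auto intro: continuous_on_subset)
    ultimately obtain t where "s \<le> t" "t \<le> b" "h t = y"
      using IVT'[of h s y b] y sab by auto
    then show False using above[of t] \<open>h s \<noteq> y\<close> by (cases "t = s") auto
  qed
  then have "s \<notin> N" using y by blast
  then obtain d where d: "d \<le> c" "(g has_real_derivative d) (at s within {s..})"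
    using sab by (auto simp: N_def)
  have "(h has_real_derivative (d - c')) (at s within {s..})"
    unfolding h_def by (auto intro!: derivative_eq_intros d)
  moreover have "d - c' < 0" using d c' by simp
  ultimately obtain e where e: "e > 0" "\<And>k. k > 0 \<Longrightarrow> k < e \<Longrightarrow> h (s + k) < h s"
    using has_real_derivative_neg_dec_right[of h "d - c'" s "{s..}"] by auto
  define k where "k = min (e / 2) (b - s)"
  have "0 < k" "k < e" "s + k \<le> b" using e sab by (auto simp: k_def)
  then show False using e(2)[of k] above[of "s + k"] \<open>h s = y\<close> by auto
qed

text \<open>
  The filter version of extracting a convergent subsequence: limits along \<open>F\<close> restrict to the finer
  filter \<open>G\<close>, just as limits of sequences restrict to subsequences.
\<close>

lemma compact_cluster_filter:
  fixes f :: "'a \<Rightarrow> 'b::topological_space"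
  assumes "compact K" and ev: "eventually (\<lambda>t. f t \<in> K) F" and "F \<noteq> bot"
  obtains G x where "G \<le> F" "G \<noteq> bot" "x \<in> K" "(f \<longlongrightarrow> x) G"
proof -
  obtain x where x: "x \<in> K" "inf (nhds x) (filtermap f F) \<noteq> bot"
    using assms(1)[unfolded compact_filter, rule_format, of "filtermap f F"] ev \<open>F \<noteq> bot\<close>
    by (auto simp: filtermap_bot_iff eventually_filtermap)
  define G where "G = inf F (filtercomap f (nhds x))"
  have "G \<noteq> bot"
  proof
    assume "G = bot"
    then obtain P Q where PQ: "eventually P F" "eventually Q (nhds x)" "\<And>t. P t \<Longrightarrow> Q (f t) \<Longrightarrow> False"
      unfolding G_def trivial_limit_def eventually_inf eventually_filtercomap by blast
    have "eventually (\<lambda>z. \<not> Q z) (filtermap f F)"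
      unfolding eventually_filtermap using PQ(1) by eventually_elim (use PQ(3) in blast)
    then have "eventually (\<lambda>z. False) (inf (nhds x) (filtermap f F))"
      unfolding eventually_inf using PQ(2) by blast
    with x(2) show False by (simp add: trivial_limit_def)
  qed
  moreover have "(f \<longlongrightarrow> x) G"
    unfolding G_def filterlim_iff_le_filtercomap by simp
  moreover have "G \<le> F" by (simp add: G_def)
  ultimately show thesis using that x(1) by blast
qed

text \<open>
  If convergence failed, the part of the filter staying outside some neighbourhood of \<open>l\<close> would still
  have a cluster point by compactness.
\<close>

lemma tendsto_unique_cluster_point:
  fixes f :: "'a \<Rightarrow> 'b::topological_space"
  assumes K: "compact K" "eventually (\<lambda>t. f t \<in> K) F"
    and uniq: "\<And>G x. G \<le> F \<Longrightarrow> G \<noteq> bot \<Longrightarrow> x \<in> K \<Longrightarrow> (f \<longlongrightarrow> x) G \<Longrightarrow> x = l"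
  shows "(f \<longlongrightarrow> l) F"
proof (rule topological_tendstoI, rule ccontr)
  fix U assume U: "open U" "l \<in> U" "\<not> eventually (\<lambda>t. f t \<in> U) F"
  define F' where "F' = inf F (principal {t. f t \<notin> U})"
  have "F' \<noteq> bot"
    using U(3) by (simp add: F'_def trivial_limit_def eventually_inf_principal)
  moreover have "eventually (\<lambda>t. f t \<in> K) F'"
    using K(2) by (rule filter_leD[rotated]) (simp add: F'_def)
  ultimately obtain G x where G: "G \<le> F'" "G \<noteq> bot" "x \<in> K" "(f \<longlongrightarrow> x) G"
    using compact_cluster_filter[OF K(1)] by metis
  have "G \<le> F" using G(1) by (simp add: F'_def)
  then have "x = l" using uniq G by blast
  then have "eventually (\<lambda>t. f t \<in> U) G" using G(4) U by (auto simp: tendsto_def)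
  moreover have "eventually (\<lambda>t. f t \<notin> U) F'" by (simp add: F'_def eventually_inf_principal)
  then have "eventually (\<lambda>t. f t \<notin> U) G" using G(1) by (rule filter_leD[rotated])
  ultimately have "eventually (\<lambda>t. False) G" by eventually_elim simp
  with G(2) show False by (simp add: trivial_limit_def)
qed

lemma antimono_bounded_below_convergent_at_top:
  fixes f :: "real \<Rightarrow> real"
  assumes anti: "\<And>s t. 0 \<le> s \<Longrightarrow> s \<le> t \<Longrightarrow> f t \<le> f s" and bd: "\<And>t. 0 \<le> t \<Longrightarrow> c \<le> f t"
  shows "\<exists>l. (f \<longlongrightarrow> l) at_top"
proof
  have bdd: "bdd_below (f ` {0..})" unfolding bdd_below_def using bd by auto
  show "(f \<longlongrightarrow> Inf (f ` {0..})) at_top"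
  proof (rule order_tendstoI)
    fix a assume a: "a < Inf (f ` {0..})"
    show "\<forall>\<^sub>F t in at_top. a < f t"
      using eventually_ge_at_top[of 0]
      by eventually_elim (use a cInf_lower[OF _ bdd] in force)
  next
    fix a assume "Inf (f ` {0..}) < a"
    then obtain s where s: "0 \<le> s" "f s < a" using cInf_less_iff[OF _ bdd] by auto
    show "\<forall>\<^sub>F t in at_top. f t < a"
      using eventually_ge_at_top[of s] by eventually_elim (use s anti in force)
  qed
qed

text \<open>
  This is l'Hospital's rule for the quotient of the integral by \<open>t\<close>.
\<close>

lemma tendsto_average:
  fixes g :: "real \<Rightarrow> real"
  assumes cont: "continuous_on {0..} g" and lim: "(g \<longlongrightarrow> l) at_top"
  shows "((\<lambda>t. (1 / t) * integral {0..t} g) \<longlongrightarrow> l) at_top"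
proof -
  have D: "((\<lambda>t. integral {0..t} g) has_real_derivative g x) (at x)" if "x > 0" for x
  proof -
    have "((\<lambda>t. integral {0..t} g) has_real_derivative g x) (at x within {0..x+1})"
      using that by (intro integral_has_real_derivative continuous_on_subset[OF cont]) auto
    then show ?thesis
      using that by (subst (asm) at_within_interior) (auto simp: interior_atLeastAtMost_real)
  qed
  have "((\<lambda>x. integral {0..x} g / x) \<longlongrightarrow> l) at_top"
  proof (rule lhospital_at_top_at_top[where f' = g and g' = "\<lambda>_. 1"])
    show "filterlim (\<lambda>x::real. x) at_top at_top" by (rule filterlim_ident)
    show "\<forall>\<^sub>F x in at_top. ((\<lambda>x. integral {0..x} g) has_real_derivative g x) (at x)"
      using eventually_gt_at_top[of 0] by eventually_elim (rule D)
  qed (use lim in auto)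
  then show ?thesis by simp
qed

lemma has_vector_derivative_iff_quotient:
  fixes u :: "real \<Rightarrow> 'a::real_normed_vector"
  shows "(u has_vector_derivative v) (at t within S) \<longleftrightarrow>
         ((\<lambda>s. (1 / (s - t)) *\<^sub>R (u s - u t)) \<longlongrightarrow> v) (at t within S)"
proof -
  have "(u has_vector_derivative v) (at t within S) \<longleftrightarrow>
      ((\<lambda>s. norm ((1 / norm (s - t)) *\<^sub>R (u s - (u t + (s - t) *\<^sub>R v)))) \<longlongrightarrow> 0) (at t within S)"
    unfolding has_vector_derivative_def has_derivative_within
    by (simp only: bounded_linear_scaleR_left simp_thms tendsto_norm_zero_iff)
  also have "\<dots> \<longleftrightarrow> ((\<lambda>s. norm ((1 / (s - t)) *\<^sub>R (u s - u t) - v)) \<longlongrightarrow> 0) (at t within S)"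
  proof (rule filterlim_cong[OF refl refl])
    have "norm ((1 / norm (s - t)) *\<^sub>R (u s - (u t + (s - t) *\<^sub>R v)))
          = norm ((1 / (s - t)) *\<^sub>R (u s - u t) - v)" if "s \<noteq> t" for s
    proof -
      let ?d = "u s - (u t + (s - t) *\<^sub>R v)"
      have v: "(1 / (s - t)) *\<^sub>R (s - t) *\<^sub>R v = v" using that by simp
      have "(1 / (s - t)) *\<^sub>R (u s - u t) - v = (1 / (s - t)) *\<^sub>R (u s - u t - (s - t) *\<^sub>R v)"
        unfolding scaleR_diff_right[of _ "u s - u t"] v ..
      also have "u s - u t - (s - t) *\<^sub>R v = ?d" by (rule diff_diff_add)
      finally have "norm ((1 / (s - t)) *\<^sub>R (u s - u t) - v) = \<bar>1 / (s - t)\<bar> * norm ?d"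
        by (simp only: norm_scaleR)
      moreover have "norm ((1 / norm (s - t)) *\<^sub>R ?d) = \<bar>1 / (s - t)\<bar> * norm ?d"
        unfolding norm_scaleR by simp
      ultimately show ?thesis by (simp only:)
    qed
    then show "\<forall>\<^sub>F s in at t within S. norm ((1 / norm (s - t)) *\<^sub>R (u s - (u t + (s - t) *\<^sub>R v)))
          = norm ((1 / (s - t)) *\<^sub>R (u s - u t) - v)"
      by (simp add: eventually_at_filter)
  qed
  also have "\<dots> \<longleftrightarrow> ((\<lambda>s. (1 / (s - t)) *\<^sub>R (u s - u t)) \<longlongrightarrow> v) (at t within S)"
    unfolding tendsto_norm_zero_iff by (rule Lim_null[symmetric])
  finally show ?thesis .
qed

lemma has_vector_derivative_right_norm_le:
  fixes u :: "real \<Rightarrow> 'a::real_normed_vector"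
  assumes der: "(u has_vector_derivative v) (at t within {t..})" 
    and bd: "\<And>s. t < s \<Longrightarrow> norm (u s - u t) \<le> L * (s - t)"
  shows "norm v \<le> L"
proof (rule tendsto_upperbound)
  have "((\<lambda>s. (1 / (s - t)) *\<^sub>R (u s - u t)) \<longlongrightarrow> v) (at t within {t..})"
    using der by (simp only: has_vector_derivative_iff_quotient)
  then show "((\<lambda>s. norm ((1 / (s - t)) *\<^sub>R (u s - u t))) \<longlongrightarrow> norm v) (at_right t)"
    by (intro tendsto_norm) (simp add: at_within_Ici_at_right)
  show "\<forall>\<^sub>F s in at_right t. norm ((1 / (s - t)) *\<^sub>R (u s - u t)) \<le> L"
    using eventually_at_right_less[of t]
  proof eventually_elim
    case (elim s)
    have "norm ((1 / (s - t)) *\<^sub>R (u s - u t)) = norm (u s - u t) / (s - t)"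
      unfolding norm_scaleR using elim by simp
    also have "\<dots> \<le> L"
      using bd[OF elim] elim by (simp add: pos_divide_le_eq)
    finally show ?case .
  qed
qed simp

lemma inner_self_lipschitz_on:
  fixes w :: "real \<Rightarrow> 'a::real_inner"
  assumes lip: "L-lipschitz_on S w" and bd: "\<And>s. s \<in> S \<Longrightarrow> norm (w s) \<le> D" and "0 \<le> D"
  shows "(2 * D * L)-lipschitz_on S (\<lambda>s. w s \<bullet> w s)"
proof (rule lipschitz_onI)
  fix s t assume st: "s \<in> S" "t \<in> S"
  have "w s \<bullet> w s - w t \<bullet> w t = (w s - w t) \<bullet> (w s + w t)"
    by (simp add: inner_diff_left inner_add_right inner_diff_right inner_commute)
  then have "dist (w s \<bullet> w s) (w t \<bullet> w t) \<le> norm (w s - w t) * norm (w s + w t)"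
    unfolding dist_real_def by (metis Cauchy_Schwarz_ineq2)
  also have "\<dots> \<le> (L * dist s t) * (2 * D)"
    using lipschitz_on_normD[OF lip st] norm_triangle_le[of "w s" "w t" "2 * D"] bd[OF st(1)] bd[OF st(2)] lipschitz_on_nonneg[OF lip]
    by (intro mult_mono) (auto simp: dist_real_def)
  finally show "dist (w s \<bullet> w s) (w t \<bullet> w t) \<le> 2 * D * L * dist s t" by (simp add: ac_simps)
qed (use lipschitz_on_nonneg[OF lip] \<open>0 \<le> D\<close> in simp)

lemma has_real_derivative_inner_self:
  fixes w :: "real \<Rightarrow> 'a::real_inner"
  assumes "(w has_vector_derivative w') (at t within S)"
  shows "((\<lambda>s. w s \<bullet> w s) has_real_derivative 2 * (w' \<bullet> w t)) (at t within S)"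
  using has_derivative_inner[OF assms[unfolded has_vector_derivative_def] assms[unfolded has_vector_derivative_def]]
  unfolding has_field_derivative_def
  by (rule has_derivative_eq_rhs) (auto simp: inner_commute algebra_simps)

lemma has_real_derivative_inner_const:
  fixes w :: "real \<Rightarrow> 'a::real_inner"
  assumes "(w has_vector_derivative w') (at t within S)"
  shows "((\<lambda>s. w s \<bullet> a) has_real_derivative w' \<bullet> a) (at t within S)"
  using has_derivative_inner_left[OF assms[unfolded has_vector_derivative_def], of a]
  unfolding has_field_derivative_def
  by (rule has_derivative_eq_rhs) (auto simp: mult.commute)

section \<open>Approximate solutions of a monotone variational inequality\<close>

locale monotone_inequality =
  fixes K :: "'a::euclidean_space set" and A :: "'a \<Rightarrow> 'a" and \<Lambda> :: real
  assumes compact_K: "compact K" and convex_K: "convex K"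
    and A_mono: "\<And>x y. x \<in> K \<Longrightarrow> y \<in> K \<Longrightarrow> 0 \<le> (A x - A y) \<bullet> (x - y)"
    and A_lipschitz: "\<Lambda>-lipschitz_on K A"
begin

text \<open>
  \<open>D\<close> and \<open>M\<close> bound the distances in \<open>K\<close> and the size of \<open>A\<close>; including \<open>0\<close> in the supremum makes
  \<open>M\<close> meaningful for empty \<open>K\<close>.
\<close>

definition D :: real where "D = diameter K"

definition M :: real where "M = Sup (insert 0 ((\<lambda>x. norm (A x)) ` K))"

lemma closed_K: "closed K"
  using compact_K by (rule compact_imp_closed)

lemma norm_diff_le_D: "x \<in> K \<Longrightarrow> y \<in> K \<Longrightarrow> norm (x - y) \<le> D"
  using diameter_bounded_bound[OF compact_imp_bounded[OF compact_K]] by (simp add: D_def dist_norm)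

lemma D_nonneg: "0 \<le> D"
  by (simp add: D_def diameter_ge_0 compact_imp_bounded[OF compact_K])

lemma bdd_A: "bdd_above (insert 0 ((\<lambda>x. norm (A x)) ` K))"
proof -
  have "continuous_on K (\<lambda>x. norm (A x))"
    by (intro continuous_on_norm lipschitz_on_continuous_on[OF A_lipschitz])
  then have "compact (insert 0 ((\<lambda>x. norm (A x)) ` K))"
    using compact_K by (intro compact_insert compact_continuous_image)
  then show ?thesis by (intro bounded_imp_bdd_above compact_imp_bounded)
qed

lemma norm_A_le: "x \<in> K \<Longrightarrow> norm (A x) \<le> M"
  unfolding M_def by (intro cSup_upper bdd_A) auto

lemma M_nonneg: "0 \<le> M"
  unfolding M_def by (intro cSup_upper bdd_A) auto

lemma \<Lambda>_nonneg: "0 \<le> \<Lambda>"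
  using A_lipschitz by (rule lipschitz_on_nonneg)

lemma norm_A_diff_le: "x \<in> K \<Longrightarrow> y \<in> K \<Longrightarrow> norm (A x - A y) \<le> \<Lambda> * norm (x - y)"
  using A_lipschitz by (rule lipschitz_on_normD)

text \<open>
  Right derivatives are the common ground of all paths to be compared: Euler paths and their limits have
  them everywhere, Lipschitz solutions almost everywhere.
\<close>

definition eps_solution :: "real \<Rightarrow> (real \<Rightarrow> 'a) \<Rightarrow> bool" where
  "eps_solution \<epsilon> u \<longleftrightarrow>
     (\<forall>t\<ge>0. u t \<in> K) \<and> (\<exists>L. L-lipschitz_on {0..} u) \<and>
     (AE t in lebesgue. 0 \<le> t \<longrightarrow>
        (\<exists>v. (u has_vector_derivative v) (at t within {t..}) \<and>
             (\<forall>y\<in>K. - \<epsilon> \<le> (v + A (u t)) \<bullet> (y - u t))))"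

text \<open>
  Testing each inequality with the other path and adding, monotonicity cancels the field and leaves
  \<open>(u' - v') \<bullet> (u - v) \<le> \<epsilon> + \<delta>\<close>.
\<close>

lemma eps_solution_contraction:
  assumes u: "eps_solution \<epsilon> u" and v: "eps_solution \<delta> v" and st: "0 \<le> s" "s \<le> t"
  shows "(norm (u t - v t))\<^sup>2 \<le> (norm (u s - v s))\<^sup>2 + 2 * (\<epsilon> + \<delta>) * (t - s)"
proof -
  obtain L L' where L: "L-lipschitz_on {0..} u" "L'-lipschitz_on {0..} v"
    using u v unfolding eps_solution_def by blast
  have K: "u \<tau> \<in> K" "v \<tau> \<in> K" if "0 \<le> \<tau>" for \<tau>
    using u v that unfolding eps_solution_def by blast+
  have "(u t - v t) \<bullet> (u t - v t) - (u s - v s) \<bullet> (u s - v s) \<le> 2 * (\<epsilon> + \<delta>) * (t - s)"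
  proof (rule lipschitz_right_derivative_bound[OF _ st(2)])
    show "(2 * D * (L + L'))-lipschitz_on {s..t} (\<lambda>\<tau>. (u \<tau> - v \<tau>) \<bullet> (u \<tau> - v \<tau>))"
      using L st by (intro inner_self_lipschitz_on lipschitz_on_diff norm_diff_le_D K D_nonneg)
        (auto intro: lipschitz_on_subset)
    have "AE \<tau> in lebesgue. 0 \<le> \<tau> \<longrightarrow>
        (\<exists>w. (u has_vector_derivative w) (at \<tau> within {\<tau>..}) \<and>
             (\<forall>y\<in>K. - \<epsilon> \<le> (w + A (u \<tau>)) \<bullet> (y - u \<tau>)))"
      "AE \<tau> in lebesgue. 0 \<le> \<tau> \<longrightarrow>
        (\<exists>w. (v has_vector_derivative w) (at \<tau> within {\<tau>..}) \<and>
             (\<forall>y\<in>K. - \<delta> \<le> (w + A (v \<tau>)) \<bullet> (y - v \<tau>)))"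
      using u v unfolding eps_solution_def by blast+
    then show "AE \<tau> in lebesgue. s \<le> \<tau> \<and> \<tau> < t \<longrightarrow>
       (\<exists>d\<le>2 * (\<epsilon> + \<delta>).
           ((\<lambda>\<tau>. (u \<tau> - v \<tau>) \<bullet> (u \<tau> - v \<tau>)) has_real_derivative d) (at \<tau> within {\<tau>..}))"
    proof eventually_elim
      case (elim \<tau>)
      show ?case
      proof safe
        assume "s \<le> \<tau>" "\<tau> < t"
        then have "0 \<le> \<tau>" using st by simp
        obtain a where a: "(u has_vector_derivative a) (at \<tau> within {\<tau>..})"
            "- \<epsilon> \<le> (a + A (u \<tau>)) \<bullet> (v \<tau> - u \<tau>)"
          using elim(1) K[OF \<open>0 \<le> \<tau>\<close>] \<open>0 \<le> \<tau>\<close> by blast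
        obtain b where b: "(v has_vector_derivative b) (at \<tau> within {\<tau>..})"
            "- \<delta> \<le> (b + A (v \<tau>)) \<bullet> (u \<tau> - v \<tau>)"
          using elim(2) K[OF \<open>0 \<le> \<tau>\<close>] \<open>0 \<le> \<tau>\<close> by blast
        have "((\<lambda>\<tau>. (u \<tau> - v \<tau>) \<bullet> (u \<tau> - v \<tau>)) has_real_derivative 2 * ((a - b) \<bullet> (u \<tau> - v \<tau>)))
            (at \<tau> within {\<tau>..})"
          by (intro has_real_derivative_inner_self has_vector_derivative_diff a b)
        moreover have "2 * ((a - b) \<bullet> (u \<tau> - v \<tau>)) \<le> 2 * (\<epsilon> + \<delta>)"
          using a(2) b(2) A_mono[OF K[OF \<open>0 \<le> \<tau>\<close>]]
          by (simp add: inner_diff_left inner_diff_right inner_add_left)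
        ultimately show "\<exists>d\<le>2 * (\<epsilon> + \<delta>).
           ((\<lambda>\<tau>. (u \<tau> - v \<tau>) \<bullet> (u \<tau> - v \<tau>)) has_real_derivative d) (at \<tau> within {\<tau>..})" by blast
      qed
    qed
  qed
  then show ?thesis by (simp add: power2_norm_eq_inner)
qed

text \<open>
  The variational inequality for increments instead of derivatives, with \<open>A\<close> and the test vector
  frozen at any time \<open>r\<close> of the interval.  This form survives pointwise limits, and the choices
  \<open>r = s\<close> and \<open>r = t\<close> control right and left difference quotients.
\<close>

lemma eps_solution_increment:
  assumes u: "eps_solution \<epsilon> u" and L: "L-lipschitz_on {0..} u"
    and st: "0 \<le> s" "s \<le> r" "r \<le> t" and y: "y \<in> K"
  shows "- (\<epsilon> + (\<Lambda> * D + M + L) * L * (t - s)) * (t - s)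
           \<le> (u t - u s + (t - s) *\<^sub>R A (u r)) \<bullet> (y - u r)"
proof -
  have K: "u \<tau> \<in> K" if "0 \<le> \<tau>" for \<tau> using u that unfolding eps_solution_def by blast
  have L0: "0 \<le> L" using L by (rule lipschitz_on_nonneg)
  have r0: "0 \<le> r" using st by simp
  \<comment> \<open>Replacing time \<open>\<tau>\<close> by \<open>r\<close> costs \<open>\<Lambda> D\<close> in the argument of \<open>A\<close> and \<open>M + L\<close> in the test vector, per unit of \<open>|u \<tau> - u r|\<close>.\<close>
  define c where "c = \<epsilon> + (\<Lambda> * D + M + L) * L * (t - s)"
  define g where "g \<tau> = - (u \<tau> \<bullet> (y - u r)) - \<tau> * (A (u r) \<bullet> (y - u r))" for \<tau>
  have "g t - g s \<le> c * (t - s)"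
  proof (rule lipschitz_right_derivative_bound)
    have lin: "(norm (y - u r) * L)-lipschitz_on {s..t} (\<lambda>\<tau>. u \<tau> \<bullet> (y - u r))"
    proof (rule lipschitz_onI)
      fix p q assume pq: "p \<in> {s..t}" "q \<in> {s..t}"
      have "dist (u p \<bullet> (y - u r)) (u q \<bullet> (y - u r)) \<le> norm (u p - u q) * norm (y - u r)"
        unfolding dist_real_def using Cauchy_Schwarz_ineq2[of "u p - u q" "y - u r"]
        by (simp add: inner_diff_left)
      also have "\<dots> \<le> (L * dist p q) * norm (y - u r)"
        using lipschitz_on_normD[OF L, of p q] pq st by (intro mult_right_mono) (auto simp: dist_real_def)
      finally show "dist (u p \<bullet> (y - u r)) (u q \<bullet> (y - u r)) \<le> norm (y - u r) * L * dist p q"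
        by (simp add: ac_simps)
    qed (use L0 in simp)
    have lin2: "(\<bar>A (u r) \<bullet> (y - u r)\<bar>)-lipschitz_on {s..t} (\<lambda>\<tau>. \<tau> * (A (u r) \<bullet> (y - u r)))"
      by (rule lipschitz_onI) (auto simp: dist_real_def abs_mult simp flip: left_diff_distrib)
    show "(norm (y - u r) * L + \<bar>A (u r) \<bullet> (y - u r)\<bar>)-lipschitz_on {s..t} g"
      unfolding g_def by (intro lipschitz_on_diff lipschitz_on_minus lin lin2)
    show "s \<le> t" using st by simp
    have "AE \<tau> in lebesgue. 0 \<le> \<tau> \<longrightarrow>
        (\<exists>w. (u has_vector_derivative w) (at \<tau> within {\<tau>..}) \<and>
             (\<forall>y\<in>K. - \<epsilon> \<le> (w + A (u \<tau>)) \<bullet> (y - u \<tau>)))"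
      using u unfolding eps_solution_def by blast
    then show "AE \<tau> in lebesgue. s \<le> \<tau> \<and> \<tau> < t \<longrightarrow>
       (\<exists>d\<le>c. (g has_real_derivative d) (at \<tau> within {\<tau>..}))"
    proof eventually_elim
      case (elim \<tau>)
      show ?case
      proof safe
        assume \<tau>: "s \<le> \<tau>" "\<tau> < t"
        then have "0 \<le> \<tau>" using st by simp
        then obtain v where v: "(u has_vector_derivative v) (at \<tau> within {\<tau>..})"
            "- \<epsilon> \<le> (v + A (u \<tau>)) \<bullet> (y - u \<tau>)"
          using elim y by blast
        have nv: "norm v \<le> L"
        proof (rule has_vector_derivative_right_norm_le[OF v(1)])
          fix \<sigma> assume "\<tau> < \<sigma>"
          then show "norm (u \<sigma> - u \<tau>) \<le> L * (\<sigma> - \<tau>)"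
            using lipschitz_on_normD[OF L, of \<sigma> \<tau>] \<open>0 \<le> \<tau>\<close> by simp
        qed
        have close: "norm (u \<tau> - u r) \<le> L * (t - s)"
        proof -
          have "norm (u \<tau> - u r) \<le> L * \<bar>\<tau> - r\<bar>"
            using lipschitz_on_normD[OF L, of \<tau> r] \<open>0 \<le> \<tau>\<close> r0 by simp
          also have "\<dots> \<le> L * (t - s)" using \<tau> st L0 by (intro mult_left_mono) auto
          finally show ?thesis .
        qed
        have "(A (u \<tau>) - A (u r)) \<bullet> (y - u r) \<le> (\<Lambda> * (L * (t - s))) * D"
        proof -
          have "norm (A (u \<tau>) - A (u r)) \<le> \<Lambda> * (L * (t - s))"
            using norm_A_diff_le[OF K[OF \<open>0 \<le> \<tau>\<close>] K[OF r0]] mult_left_mono[OF close \<Lambda>_nonneg] by simp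
          moreover have "norm (y - u r) \<le> D" using y K[OF r0] by (rule norm_diff_le_D)
          moreover have "0 \<le> \<Lambda> * (L * (t - s))" using \<Lambda>_nonneg L0 st by simp
          ultimately show ?thesis
            using norm_cauchy_schwarz[of "A (u \<tau>) - A (u r)" "y - u r"]
            by (meson mult_mono norm_ge_zero order_trans)
        qed
        moreover have "- ((v + A (u \<tau>)) \<bullet> (u \<tau> - u r)) \<le> (L + M) * (L * (t - s))"
        proof -
          have "norm (v + A (u \<tau>)) \<le> L + M"
            using nv norm_A_le[OF K[OF \<open>0 \<le> \<tau>\<close>]] by (intro norm_triangle_le) simp
          moreover have "- ((v + A (u \<tau>)) \<bullet> (u \<tau> - u r)) \<le> norm (v + A (u \<tau>)) * norm (u \<tau> - u r)"
            using Cauchy_Schwarz_ineq2[of "v + A (u \<tau>)" "u \<tau> - u r"] by linarith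
          moreover have "0 \<le> L + M" using L0 M_nonneg by simp
          ultimately show ?thesis using close
            by (meson mult_mono norm_ge_zero order_trans)
        qed
        ultimately have "- (v \<bullet> (y - u r)) - A (u r) \<bullet> (y - u r) \<le> c"
          using v(2) by (simp add: c_def algebra_simps inner_diff_left inner_diff_right inner_add_left)
        moreover have "(g has_real_derivative (- (v \<bullet> (y - u r)) - A (u r) \<bullet> (y - u r))) (at \<tau> within {\<tau>..})"
          unfolding g_def
          by (auto intro!: derivative_eq_intros has_real_derivative_inner_const[OF v(1)])
        ultimately show "\<exists>d\<le>c. (g has_real_derivative d) (at \<tau> within {\<tau>..})" by blast
      qed
    qed
  qed
  then show ?thesis
    by (simp add: g_def c_def algebra_simps inner_diff_left inner_add_left)
qed

text \<open>
  This is \<open>A x + N\<^sub>K x\<close>, the value at \<open>x\<close> of the maximal monotone operator: \<open>w - A x\<close> is an outward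
  normal of \<open>K\<close> at \<open>x\<close>.
\<close>

definition slopes :: "'a \<Rightarrow> 'a set" where
  "slopes x = {w. \<forall>y\<in>K. 0 \<le> (A x - w) \<bullet> (y - x)}"

text \<open>
  The distance to a fixed point \<open>z\<close> grows at most at rate \<open>norm w\<close>, because \<open>z\<close> is at rest under the
  monotone field \<open>A - w\<close>.  Pairing with \<open>\<delta>\<close> replaces the distance by \<open>sqrt (|u - z|\<^sup>2 + \<delta>\<^sup>2)\<close>, which is
  differentiable also where \<open>u = z\<close>; one lets \<open>\<epsilon> \<longrightarrow> 0\<close> and then \<open>\<delta> \<longrightarrow> 0\<close>.
\<close>

lemma eps_solution_distance:
  assumes u: "eps_solution \<epsilon> u" and "0 \<le> \<epsilon>" and z: "z \<in> K" "w \<in> slopes z" and \<delta>: "0 < \<delta>"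
    and st: "0 \<le> s" "s \<le> t"
  shows "norm (u t - z, \<delta>) \<le> norm (u s - z, \<delta>) + (norm w + \<epsilon> / \<delta>) * (t - s)"
proof -
  have K: "u \<tau> \<in> K" if "0 \<le> \<tau>" for \<tau> using u that unfolding eps_solution_def by blast
  obtain L where L: "L-lipschitz_on {0..} u" using u unfolding eps_solution_def by blast
  have "norm (u t - z, \<delta>) - norm (u s - z, \<delta>) \<le> (norm w + \<epsilon> / \<delta>) * (t - s)"
  proof (rule lipschitz_right_derivative_bound[OF _ st(2)])
    show "L-lipschitz_on {s..t} (\<lambda>\<tau>. norm (u \<tau> - z, \<delta>))"
    proof (rule lipschitz_onI)
      fix p q assume pq: "p \<in> {s..t}" "q \<in> {s..t}"
      have "dist (norm (u p - z, \<delta>)) (norm (u q - z, \<delta>)) \<le> norm ((u p - z, \<delta>) - (u q - z, \<delta>))"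
        by (simp only: dist_real_def norm_triangle_ineq3)
      also have "\<dots> = norm (u p - u q)" by (simp add: norm_Pair)
      also have "\<dots> \<le> L * dist p q"
        using lipschitz_on_normD[OF L, of p q] pq st by (auto simp: dist_real_def)
      finally show "dist (norm (u p - z, \<delta>)) (norm (u q - z, \<delta>)) \<le> L * dist p q" .
    qed (rule lipschitz_on_nonneg[OF L])
    have "AE \<tau> in lebesgue. 0 \<le> \<tau> \<longrightarrow>
        (\<exists>w. (u has_vector_derivative w) (at \<tau> within {\<tau>..}) \<and>
             (\<forall>y\<in>K. - \<epsilon> \<le> (w + A (u \<tau>)) \<bullet> (y - u \<tau>)))"
      using u unfolding eps_solution_def by blast
    then show "AE \<tau> in lebesgue. s \<le> \<tau> \<and> \<tau> < t \<longrightarrow>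
       (\<exists>d\<le>norm w + \<epsilon> / \<delta>. ((\<lambda>\<tau>. norm (u \<tau> - z, \<delta>)) has_real_derivative d) (at \<tau> within {\<tau>..}))"
    proof eventually_elim
      case (elim \<tau>)
      show ?case
      proof safe
        assume \<tau>: "s \<le> \<tau>" "\<tau> < t"
        then have "0 \<le> \<tau>" using st by simp
        then obtain v where v: "(u has_vector_derivative v) (at \<tau> within {\<tau>..})"
            "- \<epsilon> \<le> (v + A (u \<tau>)) \<bullet> (z - u \<tau>)"
          using elim z by blast
        let ?p = "(u \<tau> - z, \<delta>)"
        have p: "\<delta> \<le> norm ?p" "norm (u \<tau> - z) \<le> norm ?p" "0 < norm ?p"
          using norm_snd_le[of \<delta> "u \<tau> - z"] norm_fst_le[of "u \<tau> - z" \<delta>] \<delta> by (auto simp: zero_prod_def)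
        have "((\<lambda>\<tau>. (u \<tau> - z, \<delta>)) has_vector_derivative (v, 0)) (at \<tau> within {\<tau>..})"
          using v(1) by (auto intro!: derivative_eq_intros simp: has_vector_derivative_def)
        then have "((\<lambda>\<tau>. norm (u \<tau> - z, \<delta>)) has_derivative (\<lambda>h. (h *\<^sub>R (v, 0)) \<bullet> sgn ?p))
            (at \<tau> within {\<tau>..})"
          unfolding has_vector_derivative_def
          by (rule has_derivative_compose[OF _ has_derivative_norm]) (use p(3) in auto)
        then have "((\<lambda>\<tau>. norm (u \<tau> - z, \<delta>)) has_real_derivative (v, 0) \<bullet> sgn ?p) (at \<tau> within {\<tau>..})"
          unfolding has_field_derivative_def
          by (rule has_derivative_eq_rhs) (auto simp: inner_scaleR_left mult.commute simp del: scaleR_Pair)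
        moreover have "(v, 0) \<bullet> sgn ?p \<le> norm w + \<epsilon> / \<delta>"
        proof -
          have "v \<bullet> (u \<tau> - z) \<le> \<epsilon> + w \<bullet> (z - u \<tau>)"
            using v(2) A_mono[OF K[OF \<open>0 \<le> \<tau>\<close>] z(1)] z(2) K[OF \<open>0 \<le> \<tau>\<close>]
            unfolding slopes_def by (force simp: inner_diff_left inner_diff_right inner_add_left)
          also have "\<dots> \<le> \<epsilon> + norm w * norm (u \<tau> - z)"
            using norm_cauchy_schwarz[of w "z - u \<tau>"] by (simp add: norm_minus_commute)
          also have "\<dots> \<le> (\<epsilon> / \<delta>) * norm ?p + norm w * norm ?p"
          proof (intro add_mono mult_left_mono p)
            have "\<epsilon> = (\<epsilon> / \<delta>) * \<delta>" using \<delta> by simp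
            also have "\<dots> \<le> (\<epsilon> / \<delta>) * norm ?p" using p \<delta> \<open>0 \<le> \<epsilon>\<close> by (intro mult_left_mono) auto
            finally show "\<epsilon> \<le> (\<epsilon> / \<delta>) * norm ?p" .
          qed simp
          finally have "v \<bullet> (u \<tau> - z) / norm ?p \<le> norm w + \<epsilon> / \<delta>"
            using p(3) by (simp add: pos_divide_le_eq algebra_simps)
          then show ?thesis by (simp add: sgn_div_norm divide_inverse_commute)
        qed
        ultimately show "\<exists>d\<le>norm w + \<epsilon> / \<delta>.
           ((\<lambda>\<tau>. norm (u \<tau> - z, \<delta>)) has_real_derivative d) (at \<tau> within {\<tau>..})" by blast
      qed
    qed
  qed
  then show ?thesis by simp
qed

end

section \<open>The projected Euler scheme\<close>

definition polygonal_path :: "real \<Rightarrow> (nat \<Rightarrow> 'a::real_vector) \<Rightarrow> real \<Rightarrow> 'a" where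
  "polygonal_path h a t =
     (let n = nat \<lfloor>t / h\<rfloor> in a n + (t / h - real n) *\<^sub>R (a (Suc n) - a n))"

text \<open>
  The closed cell includes its right end point, where the floor already belongs to the next cell; the
  two formulas agree there.
\<close>

lemma polygonal_path_on_cell:
  assumes "0 < h" and t: "real n * h \<le> t" "t \<le> real (Suc n) * h"
  shows "polygonal_path h a t = a n + (t / h - real n) *\<^sub>R (a (Suc n) - a n)"
proof (cases "t = real (Suc n) * h")
  case True
  then have "t / h = real (Suc n)" using \<open>0 < h\<close> by simp
  then show ?thesis by (simp add: polygonal_path_def Let_def nat_add_distrib)
next
  case False
  then have "real n \<le> t / h" "t / h < real n + 1" using assms by (auto simp: field_simps)
  then have "\<lfloor>t / h\<rfloor> = int n" by (simp add: floor_eq_iff)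
  then show ?thesis by (simp add: polygonal_path_def Let_def)
qed

lemma cell_exists:
  fixes h t :: real
  assumes "0 < h" "0 \<le> t"
  obtains n where "real n * h \<le> t" "t < real (Suc n) * h"
proof
  let ?n = "nat \<lfloor>t / h\<rfloor>"
  have n: "real ?n \<le> t / h" "t / h < real (Suc ?n)"
    using assms floor_correct[of "t / h"] by (auto simp: add.commute)
  show "real ?n * h \<le> t" using n(1) pos_le_divide_eq[OF \<open>0 < h\<close>] by blast
  show "t < real (Suc ?n) * h" using n(2) pos_divide_less_eq[OF \<open>0 < h\<close>] by blast
qed

lemma polygonal_path_lipschitz_on:
  fixes a :: "nat \<Rightarrow> 'a::real_normed_vector"
  assumes h: "0 < h" and step: "\<And>n. norm (a (Suc n) - a n) \<le> L * h" and "0 \<le> L"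
  shows "L-lipschitz_on {0..} (polygonal_path h a)"
proof -
  let ?p = "polygonal_path h a"
  have cell: "L-lipschitz_on {real n * h..real (Suc n) * h} ?p" for n
  proof (rule lipschitz_onI[OF _ \<open>0 \<le> L\<close>])
    fix s t assume st: "s \<in> {real n * h..real (Suc n) * h}" "t \<in> {real n * h..real (Suc n) * h}"
    have "?p s - ?p t = ((s - t) / h) *\<^sub>R (a (Suc n) - a n)"
      using polygonal_path_on_cell[OF h, of n s a] polygonal_path_on_cell[OF h, of n t a] st
      by (simp add: diff_divide_distrib flip: scaleR_left.diff)
    then have "dist (?p s) (?p t) = \<bar>s - t\<bar> / h * norm (a (Suc n) - a n)"
      using h by (simp add: dist_norm)
    also have "\<dots> \<le> \<bar>s - t\<bar> / h * (L * h)"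
      using step h by (intro mult_left_mono) auto
    also have "\<dots> = L * dist s t" using h by (simp add: dist_real_def)
    finally show "dist (?p s) (?p t) \<le> L * dist s t" .
  qed
  have initial: "L-lipschitz_on {0..real n * h} ?p" for n
  proof (induction n)
    case 0
    then show ?case using \<open>0 \<le> L\<close> by (simp add: lipschitz_on_def)
  next
    case (Suc n)
    then show ?case using lipschitz_on_concat[OF Suc cell] by simp
  qed
  show ?thesis
  proof (rule lipschitz_onI[OF _ \<open>0 \<le> L\<close>])
    fix s t :: real assume st: "s \<in> {0..}" "t \<in> {0..}"
    obtain n where "max s t < real (Suc n) * h"
      using cell_exists[OF h, of "max s t"] st by (metis atLeast_iff max.coboundedI1)
    then show "dist (?p s) (?p t) \<le> L * dist s t"
      using st by (intro lipschitz_onD[OF initial[of "Suc n"]]) auto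
  qed
qed

lemma polygonal_path_right_derivative:
  assumes h: "0 < h" and t: "real n * h \<le> t" "t < real (Suc n) * h"
  shows "(polygonal_path h a has_vector_derivative (1 / h) *\<^sub>R (a (Suc n) - a n)) (at t within {t..})"
proof -
  have "((\<lambda>s. a n + (s / h - real n) *\<^sub>R (a (Suc n) - a n)) has_vector_derivative
      (1 / h) *\<^sub>R (a (Suc n) - a n)) (at t within {t..})"
    unfolding has_vector_derivative_def
    using h by (auto intro!: derivative_eq_intros)
  then show ?thesis
  proof (rule has_vector_derivative_transform_within)
    show "0 < real (Suc n) * h - t" "t \<in> {t..}" using t by auto
    fix s assume "s \<in> {t..}" "dist s t < real (Suc n) * h - t"
    then show "a n + (s / h - real n) *\<^sub>R (a (Suc n) - a n) = polygonal_path h a s"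
      using t by (intro polygonal_path_on_cell[OF h, symmetric]) (auto simp: dist_real_def)
  qed
qed

context monotone_inequality
begin

primrec euler :: "real \<Rightarrow> 'a \<Rightarrow> nat \<Rightarrow> 'a" where
  "euler h x 0 = x"
| "euler h x (Suc n) = closest_point K (euler h x n - h *\<^sub>R A (euler h x n))"

lemma euler_in_K: "x \<in> K \<Longrightarrow> euler h x n \<in> K"
proof (induction n)
  case (Suc n)
  then show ?case using closest_point_in_set[OF closed_K] by auto
qed simp

lemma euler_step_norm:
  assumes "0 < h" "x \<in> K"
  shows "norm (euler h x (Suc n) - euler h x n) \<le> M * h"
proof -
  let ?e = "euler h x n"
  have e: "?e \<in> K" by (rule euler_in_K[OF assms(2)])
  have "norm (euler h x (Suc n) - ?e)
        = dist (closest_point K (?e - h *\<^sub>R A ?e)) (closest_point K ?e)"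
    by (simp add: dist_norm closest_point_self[OF e])
  also have "\<dots> \<le> dist (?e - h *\<^sub>R A ?e) ?e"
    using e by (intro closest_point_lipschitz convex_K closed_K) auto
  also have "\<dots> \<le> M * h"
    using norm_A_le[OF e] assms by (simp add: dist_norm mult.commute)
  finally show ?thesis .
qed

text \<open>
  The characterisation of the nearest point, read as an implicit Euler inequality at the new point with
  the field taken at the old one.
\<close>

lemma euler_step_inequality:
  assumes "0 < h" "y \<in> K"
  shows "0 \<le> ((1 / h) *\<^sub>R (euler h x (Suc n) - euler h x n) + A (euler h x n)) \<bullet> (y - euler h x (Suc n))"
proof -
  let ?e = "euler h x n" and ?e' = "euler h x (Suc n)"
  have "(?e - h *\<^sub>R A ?e - ?e') \<bullet> (y - ?e') \<le> 0"
    using closest_point_dot[OF convex_K closed_K assms(2)] by simp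
  moreover have "?e - h *\<^sub>R A ?e - ?e' = - (h *\<^sub>R ((1 / h) *\<^sub>R (?e' - ?e) + A ?e))"
    using assms(1) by (simp add: scaleR_add_right)
  ultimately have "0 \<le> h * (((1 / h) *\<^sub>R (?e' - ?e) + A ?e) \<bullet> (y - ?e'))"
    by simp
  then show ?thesis using assms(1) by (simp only: zero_le_mult_iff) auto
qed

definition euler_path :: "real \<Rightarrow> 'a \<Rightarrow> real \<Rightarrow> 'a" where
  "euler_path h x = polygonal_path h (euler h x)"

text \<open>
  The constant collects the cost of moving the test point and the argument of \<open>A\<close> by at most one Euler
  step, which has length at most \<open>M * h\<close>.
\<close>

definition euler_error :: real where
  "euler_error = (\<Lambda> * D + 2 * M) * M"

lemma euler_error_nonneg: "0 \<le> euler_error"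
  by (simp add: euler_error_def \<Lambda>_nonneg D_nonneg M_nonneg)

lemma euler_path_lipschitz_on: "0 < h \<Longrightarrow> x \<in> K \<Longrightarrow> M-lipschitz_on {0..} (euler_path h x)"
  unfolding euler_path_def
  by (intro polygonal_path_lipschitz_on euler_step_norm M_nonneg)

lemma euler_path_0: "0 < h \<Longrightarrow> euler_path h x 0 = x"
  by (simp add: euler_path_def polygonal_path_def)

lemma euler_path_eps_solution:
  assumes h: "0 < h" and x: "x \<in> K"
  shows "eps_solution (euler_error * h) (euler_path h x)"
proof -
  let ?u = "euler_path h x"
  have main: "?u t \<in> K \<and> (\<exists>v. (?u has_vector_derivative v) (at t within {t..}) \<and>
             (\<forall>y\<in>K. - (euler_error * h) \<le> (v + A (?u t)) \<bullet> (y - ?u t)))" if "0 \<le> t" for t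
  proof -
    obtain n where n: "real n * h \<le> t" "t < real (Suc n) * h"
      using cell_exists[OF h \<open>0 \<le> t\<close>] .
    let ?e = "euler h x n" and ?e' = "euler h x (Suc n)"
    define v where "v = (1 / h) *\<^sub>R (?e' - ?e)"
    define \<theta> where "\<theta> = t / h - real n"
    have \<theta>: "0 \<le> \<theta>" "\<theta> \<le> 1" using n h by (auto simp: \<theta>_def field_simps)
    have e: "?e \<in> K" "?e' \<in> K" using euler_in_K[OF x] by blast+
    have ut: "?u t = ?e + \<theta> *\<^sub>R (?e' - ?e)"
      unfolding euler_path_def \<theta>_def using n by (intro polygonal_path_on_cell[OF h]) auto
    have "?u t = (1 - \<theta>) *\<^sub>R ?e + \<theta> *\<^sub>R ?e'" by (simp add: ut algebra_simps)
    then have K: "?u t \<in> K" using convexD_alt[OF convex_K e \<theta>] by simp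
    have nv: "norm v \<le> M"
      unfolding v_def norm_scaleR using euler_step_norm[OF h x, of n] h
      by (simp add: pos_divide_le_eq del: euler.simps)
    have close: "norm (?u t - ?e) \<le> M * h" "norm (?e' - ?u t) \<le> M * h"
    proof -
      have "norm (\<theta> *\<^sub>R (?e' - ?e)) \<le> norm (?e' - ?e)"
        "norm ((1 - \<theta>) *\<^sub>R (?e' - ?e)) \<le> norm (?e' - ?e)"
        using \<theta> by (simp_all add: mult_left_le_one_le del: euler.simps)
      moreover have "?u t - ?e = \<theta> *\<^sub>R (?e' - ?e)" "?e' - ?u t = (1 - \<theta>) *\<^sub>R (?e' - ?e)"
        by (simp_all add: ut algebra_simps)
      ultimately show "norm (?u t - ?e) \<le> M * h" "norm (?e' - ?u t) \<le> M * h"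
        using euler_step_norm[OF h x, of n] by (metis order_trans)+
    qed
    have "- (euler_error * h) \<le> (v + A (?u t)) \<bullet> (y - ?u t)" if y: "y \<in> K" for y
    proof -
      have 1: "0 \<le> (v + A ?e) \<bullet> (y - ?e')"
        unfolding v_def by (rule euler_step_inequality[OF h y])
      have "\<bar>(v + A ?e) \<bullet> (?e' - ?u t)\<bar> \<le> norm (v + A ?e) * norm (?e' - ?u t)"
        by (rule Cauchy_Schwarz_ineq2)
      also have "\<dots> \<le> (2 * M) * (M * h)"
        using nv norm_A_le[OF e(1)] close M_nonneg
        by (intro mult_mono norm_triangle_le) auto
      finally have 2: "\<bar>(v + A ?e) \<bullet> (?e' - ?u t)\<bar> \<le> (2 * M) * (M * h)" .
      have "\<bar>(A (?u t) - A ?e) \<bullet> (y - ?u t)\<bar> \<le> norm (A (?u t) - A ?e) * norm (y - ?u t)"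
        by (rule Cauchy_Schwarz_ineq2)
      also have "\<dots> \<le> (\<Lambda> * (M * h)) * D"
        using order_trans[OF norm_A_diff_le[OF K e(1)] mult_left_mono[OF close(1) \<Lambda>_nonneg]]
          norm_diff_le_D[OF y K] \<Lambda>_nonneg M_nonneg h
        by (intro mult_mono) auto
      finally have 3: "\<bar>(A (?u t) - A ?e) \<bullet> (y - ?u t)\<bar> \<le> (\<Lambda> * (M * h)) * D" .
      have "(v + A (?u t)) \<bullet> (y - ?u t)
            = (v + A ?e) \<bullet> (y - ?e') + (v + A ?e) \<bullet> (?e' - ?u t) + (A (?u t) - A ?e) \<bullet> (y - ?u t)"
        by (simp add: inner_diff_left inner_diff_right inner_add_left)
      then have "- ((2 * M) * (M * h) + (\<Lambda> * (M * h)) * D) \<le> (v + A (?u t)) \<bullet> (y - ?u t)"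
        using 1 2 3 by linarith
      then show ?thesis by (simp add: euler_error_def algebra_simps)
    qed
    moreover have "(?u has_vector_derivative v) (at t within {t..})"
      unfolding euler_path_def v_def by (rule polygonal_path_right_derivative[OF h n])
    ultimately show ?thesis using K by blast
  qed
  then have "\<forall>t\<ge>0. ?u t \<in> K"
    "AE t in lebesgue. 0 \<le> t \<longrightarrow> (\<exists>v. (?u has_vector_derivative v) (at t within {t..}) \<and>
             (\<forall>y\<in>K. - (euler_error * h) \<le> (v + A (?u t)) \<bullet> (y - ?u t)))"
    by (auto intro!: AE_I2)
  then show ?thesis
    unfolding eps_solution_def using euler_path_lipschitz_on[OF h x] by blast
qed


section \<open>The limit evolution and its differentiability\<close>

lemma euler_paths_Cauchy:
  assumes x: "x \<in> K" and t: "0 \<le> t"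
  shows "Cauchy (\<lambda>k. euler_path (1 / real (Suc k)) x t)"
proof (rule CauchyI)
  fix e :: real assume "0 < e"
  let ?u = "\<lambda>k. euler_path (1 / real (Suc k)) x"
  have dist: "(norm (?u m t - ?u n t))\<^sup>2 \<le> 2 * (euler_error * (1 / real (Suc m)) + euler_error * (1 / real (Suc n))) * t"
    for m n
    using eps_solution_contraction[OF euler_path_eps_solution euler_path_eps_solution, of "1 / real (Suc m)" x "1 / real (Suc n)" x 0 t]
      x t by (simp add: euler_path_0)
  obtain N :: nat where N: "4 * euler_error * t / e\<^sup>2 < real N" using reals_Archimedean2 by blast
  have "norm (?u m t - ?u n t) < e" if mn: "N \<le> m" "N \<le> n" for m n
  proof -
    have small: "euler_error * (1 / real (Suc k)) \<le> euler_error * (1 / real (Suc N))" if "N \<le> k" for k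
      using that euler_error_nonneg by (intro mult_left_mono divide_left_mono) auto
    have "2 * (euler_error * (1 / real (Suc m)) + euler_error * (1 / real (Suc n))) * t
        \<le> 2 * (euler_error * (1 / real (Suc N)) + euler_error * (1 / real (Suc N))) * t"
      by (rule mult_right_mono[OF mult_left_mono[OF add_mono[OF small[OF mn(1)] small[OF mn(2)]]] t]) simp
    also have "\<dots> = 4 * euler_error * t * (1 / real (Suc N))"
    proof -
      have "2 * (a * c + a * c) * t = 4 * a * t * c" for a c :: real by (simp add: algebra_simps)
      then show ?thesis .
    qed
    also have "\<dots> < e\<^sup>2"
    proof -
      have "4 * euler_error * t / e\<^sup>2 < real (Suc N)" using N by simp
      then show ?thesis
        using \<open>0 < e\<close> by (simp add: pos_divide_less_eq mult.commute del: of_nat_Suc)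
    qed
    finally have "(norm (?u m t - ?u n t))\<^sup>2 < e\<^sup>2" using dist[of m n] by linarith
    then show ?thesis using \<open>0 < e\<close> by (simp add: power_less_imp_less_base)
  qed
  then show "\<exists>N. \<forall>m\<ge>N. \<forall>n\<ge>N. norm (?u m t - ?u n t) < e" by blast
qed

definition evolution :: "'a \<Rightarrow> real \<Rightarrow> 'a" where
  "evolution x t = lim (\<lambda>k. euler_path (1 / real (Suc k)) x t)"

lemma euler_paths_converge:
  assumes "x \<in> K" "0 \<le> t"
  shows "(\<lambda>k. euler_path (1 / real (Suc k)) x t) \<longlonglongrightarrow> evolution x t"
  unfolding evolution_def
  using euler_paths_Cauchy[OF assms] by (simp only: Cauchy_convergent_iff convergent_LIMSEQ_iff)

lemma evolution_0: "x \<in> K \<Longrightarrow> evolution x 0 = x"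
  by (simp add: evolution_def euler_path_0)

lemma evolution_in_K:
  assumes "x \<in> K" "0 \<le> t"
  shows "evolution x t \<in> K"
proof (rule Lim_in_closed_set[OF closed_K _ _ euler_paths_converge[OF assms]])
  show "\<forall>\<^sub>F k in sequentially. euler_path (1 / real (Suc k)) x t \<in> K"
    using euler_path_eps_solution[OF _ assms(1)] assms(2) unfolding eps_solution_def by simp
qed simp

lemma evolution_lipschitz_on:
  assumes "x \<in> K"
  shows "M-lipschitz_on {0..} (evolution x)"
proof (rule lipschitz_onI[OF _ M_nonneg])
  fix s t :: real assume st: "s \<in> {0..}" "t \<in> {0..}"
  show "dist (evolution x s) (evolution x t) \<le> M * dist s t"
  proof (rule tendsto_upperbound)
    show "(\<lambda>k. dist (euler_path (1 / real (Suc k)) x s) (euler_path (1 / real (Suc k)) x t))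
        \<longlonglongrightarrow> dist (evolution x s) (evolution x t)"
      using st assms by (intro tendsto_dist euler_paths_converge) auto
    show "\<forall>\<^sub>F k in sequentially.
        dist (euler_path (1 / real (Suc k)) x s) (euler_path (1 / real (Suc k)) x t) \<le> M * dist s t"
      using st assms by (intro always_eventually allI lipschitz_onD[OF euler_path_lipschitz_on]) auto
  qed simp
qed

lemma euler_errors_tendsto_0: "(\<lambda>k. euler_error * (1 / real (Suc k))) \<longlonglongrightarrow> 0"
  using tendsto_mult_right[OF LIMSEQ_inverse_real_of_nat, of euler_error]
  by (simp add: inverse_eq_divide)

lemma evolution_increment:
  assumes x: "x \<in> K" and st: "0 \<le> s" "s \<le> r" "r \<le> t" and y: "y \<in> K"
  shows "- (euler_error * (t - s)) * (t - s)
           \<le> (evolution x t - evolution x s + (t - s) *\<^sub>R A (evolution x r)) \<bullet> (y - evolution x r)"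
proof (rule LIMSEQ_le)
  let ?u = "\<lambda>k. euler_path (1 / real (Suc k)) x"
  let ?\<epsilon> = "\<lambda>k. euler_error * (1 / real (Suc k))"
  have "(\<lambda>k. - (?\<epsilon> k + euler_error * (t - s)) * (t - s))
      \<longlonglongrightarrow> - (0 + euler_error * (t - s)) * (t - s)"
    by (intro tendsto_intros euler_errors_tendsto_0)
  then show "(\<lambda>k. - (?\<epsilon> k + euler_error * (t - s)) * (t - s))
      \<longlonglongrightarrow> - (euler_error * (t - s)) * (t - s)" by simp
  have lims: "(\<lambda>k. ?u k \<tau>) \<longlonglongrightarrow> evolution x \<tau>" if "0 \<le> \<tau>" for \<tau>
    using euler_paths_converge[OF x that] .
  have K: "?u k r \<in> K" for k
    using euler_path_eps_solution[OF _ x] st unfolding eps_solution_def by simp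
  have "(\<lambda>k. A (?u k r)) \<longlonglongrightarrow> A (evolution x r)"
    using st x by (intro continuous_on_tendsto_compose[OF lipschitz_on_continuous_on[OF A_lipschitz] lims]
        evolution_in_K always_eventually allI K) auto
  then show "(\<lambda>k. (?u k t - ?u k s + (t - s) *\<^sub>R A (?u k r)) \<bullet> (y - ?u k r))
      \<longlonglongrightarrow> (evolution x t - evolution x s + (t - s) *\<^sub>R A (evolution x r)) \<bullet> (y - evolution x r)"
    using st by (intro tendsto_intros lims) auto
  have "- (?\<epsilon> k + euler_error * (t - s)) * (t - s)
         \<le> (?u k t - ?u k s + (t - s) *\<^sub>R A (?u k r)) \<bullet> (y - ?u k r)" for k
  proof -
    have "(\<Lambda> * D + M + M) * M = euler_error" by (simp add: euler_error_def algebra_simps)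
    moreover have "0 < 1 / real (Suc k)" by simp
    ultimately show ?thesis
      using eps_solution_increment[OF euler_path_eps_solution[OF _ x] euler_path_lipschitz_on[OF _ x] st y]
      by (simp only:)
  qed
  then show "\<exists>N. \<forall>k\<ge>N. - (?\<epsilon> k + euler_error * (t - s)) * (t - s)
         \<le> (?u k t - ?u k s + (t - s) *\<^sub>R A (?u k r)) \<bullet> (y - ?u k r)" by blast
qed

text \<open>
  The bound is inherited from the Euler paths, because the differentiability of the limit is itself
  derived from it.
\<close>

lemma evolution_distance:
  assumes x: "x \<in> K" and st: "0 \<le> s" "s \<le> t" and w: "w \<in> slopes (evolution x s)"
  shows "norm (evolution x t - evolution x s) \<le> norm w * (t - s)"
proof (rule field_le_epsilon)
  fix \<delta> :: real assume \<delta>: "0 < \<delta>"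
  let ?u = "\<lambda>k. euler_path (1 / real (Suc k)) x" and ?z = "evolution x s"
  let ?\<epsilon> = "\<lambda>k. euler_error * (1 / real (Suc k))"
  have z: "?z \<in> K" using x st by (intro evolution_in_K) auto
  have lims: "(\<lambda>k. ?u k \<tau>) \<longlonglongrightarrow> evolution x \<tau>" if "0 \<le> \<tau>" for \<tau>
    using euler_paths_converge[OF x that] .
  have "norm (evolution x t - ?z, \<delta>) \<le> norm (?z - ?z, \<delta>) + (norm w + 0 / \<delta>) * (t - s)"
  proof (rule LIMSEQ_le)
    show "(\<lambda>k. norm (?u k t - ?z, \<delta>)) \<longlonglongrightarrow> norm (evolution x t - ?z, \<delta>)"
      using st by (intro tendsto_intros lims) auto
    show "(\<lambda>k. norm (?u k s - ?z, \<delta>) + (norm w + ?\<epsilon> k / \<delta>) * (t - s))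
        \<longlonglongrightarrow> norm (?z - ?z, \<delta>) + (norm w + 0 / \<delta>) * (t - s)"
      using st \<delta> by (intro tendsto_intros lims euler_errors_tendsto_0) auto
    have "norm (?u k t - ?z, \<delta>) \<le> norm (?u k s - ?z, \<delta>) + (norm w + ?\<epsilon> k / \<delta>) * (t - s)" for k
      using euler_error_nonneg
      by (intro eps_solution_distance euler_path_eps_solution x z w \<delta> st) auto
    then show "\<exists>N. \<forall>k\<ge>N. norm (?u k t - ?z, \<delta>)
        \<le> norm (?u k s - ?z, \<delta>) + (norm w + ?\<epsilon> k / \<delta>) * (t - s)" by blast
  qed
  then show "norm (evolution x t - ?z) \<le> norm w * (t - s) + \<delta>"
  proof -
    assume "norm (evolution x t - ?z, \<delta>) \<le> norm (?z - ?z, \<delta>) + (norm w + 0 / \<delta>) * (t - s)"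
    moreover have "norm (?z - ?z, \<delta>) = \<delta>" using \<delta> by (simp add: norm_Pair)
    ultimately show ?thesis
      using norm_fst_le[of "evolution x t - ?z" \<delta>] by simp
  qed
qed

text \<open>
  The canonical selection of smallest norm; it turns out to be minus the velocity of the
  evolution.
\<close>

definition minimal_slope :: "'a \<Rightarrow> 'a" where
  "minimal_slope x = closest_point (slopes x) 0"

lemma closed_slopes: "closed (slopes x)"
proof -
  have "slopes x = (\<Inter>y\<in>K. {w. 0 \<le> (A x - w) \<bullet> (y - x)})" by (auto simp: slopes_def)
  then show ?thesis by (auto intro!: closed_INT closed_Collect_le continuous_intros)
qed

lemma convex_slopes: "convex (slopes x)"
proof (rule convexI)
  fix v w :: 'a and a b :: real
  assume vw: "v \<in> slopes x" "w \<in> slopes x" and ab: "0 \<le> a" "0 \<le> b" "a + b = 1"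
  have "0 \<le> (A x - (a *\<^sub>R v + b *\<^sub>R w)) \<bullet> (y - x)" if "y \<in> K" for y
  proof -
    have "0 \<le> a * ((A x - v) \<bullet> (y - x)) + b * ((A x - w) \<bullet> (y - x))"
      using vw that ab by (simp add: slopes_def)
    also have "\<dots> = (a + b) * (A x \<bullet> (y - x)) - (a *\<^sub>R v + b *\<^sub>R w) \<bullet> (y - x)"
      by (simp add: inner_diff_left inner_add_left algebra_simps)
    finally show ?thesis using ab by (simp add: inner_diff_left)
  qed
  then show "a *\<^sub>R v + b *\<^sub>R w \<in> slopes x" by (simp add: slopes_def)
qed

lemma minimal_slope_in_slopes: "minimal_slope x \<in> slopes x"
proof -
  have "A x \<in> slopes x" by (simp add: slopes_def)
  then show ?thesis unfolding minimal_slope_def by (intro closest_point_in_set closed_slopes) auto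
qed

lemma minimal_slope_unique:
  assumes "w \<in> slopes x" "norm w \<le> norm (minimal_slope x)"
  shows "w = minimal_slope x"
  unfolding minimal_slope_def
proof (rule closest_point_unique[OF convex_slopes closed_slopes assms(1)])
  show "\<forall>z\<in>slopes x. dist 0 w \<le> dist 0 z"
    using assms(2) closest_point_le[OF closed_slopes, of _ x 0]
    by (fastforce simp: minimal_slope_def)
qed

text \<open>
  A cluster point \<open>\<xi>\<close> of the difference quotients satisfies the variational inequality, so \<open>- \<xi>\<close> is a
  slope, and the bound \<open>b\<close> forces it to be the minimal one.  One statement covers both right and
  two-sided derivatives through the choice of \<open>S\<close> and \<open>b\<close>.
\<close>

lemma evolution_has_derivative:
  assumes x: "x \<in> K" and t: "0 \<le> t" and S: "S \<subseteq> {0..}"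
    and b: "\<And>s. s \<in> S \<Longrightarrow> norm (evolution x s - evolution x t) \<le> b s * \<bar>s - t\<bar>"
    and lim: "(b \<longlongrightarrow> norm (minimal_slope (evolution x t))) (at t within S)"
  shows "(evolution x has_vector_derivative - minimal_slope (evolution x t)) (at t within S)"
proof -
  let ?u = "evolution x"
  let ?q = "\<lambda>s. (1 / (s - t)) *\<^sub>R (?u s - ?u t)"
  have ev: "\<forall>\<^sub>F s in at t within S. s \<in> S \<and> s \<noteq> t"
    by (auto simp: eventually_at_filter)
  have qnorm: "norm (?q s) \<le> c" if "s \<noteq> t" "norm (?u s - ?u t) \<le> c * \<bar>s - t\<bar>" for s c
    unfolding norm_scaleR using that by (simp add: pos_divide_le_eq)
  have ut: "?u t \<in> K" using x t by (rule evolution_in_K)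
  have "(?q \<longlongrightarrow> - minimal_slope (?u t)) (at t within S)"
  proof (rule tendsto_unique_cluster_point)
    show "compact (cball 0 M :: 'a set)" by simp
    show "\<forall>\<^sub>F s in at t within S. ?q s \<in> cball 0 M"
      using ev
    proof eventually_elim
      case (elim s)
      then have "norm (?u s - ?u t) \<le> M * \<bar>s - t\<bar>"
        using lipschitz_on_normD[OF evolution_lipschitz_on[OF x], of s t] t S by auto
      then show ?case using qnorm elim by simp
    qed
    fix G \<xi> assume G: "G \<le> at t within S" "G \<noteq> bot" and q: "(?q \<longlongrightarrow> \<xi>) G"
    have evG: "\<forall>\<^sub>F s in G. s \<in> S \<and> s \<noteq> t" using ev G(1) by (rule filter_leD[rotated])
    have idG: "((\<lambda>s. s) \<longlongrightarrow> t) G"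
      using G(1) tendsto_ident_at by (rule tendsto_mono)
    have "0 \<le> (\<xi> + A (?u t)) \<bullet> (y - ?u t)" if y: "y \<in> K" for y
    proof (rule tendsto_le[OF G(2)])
      show "((\<lambda>s. (?q s + A (?u t)) \<bullet> (y - ?u t)) \<longlongrightarrow> (\<xi> + A (?u t)) \<bullet> (y - ?u t)) G"
        by (intro tendsto_intros q)
      have "((\<lambda>s. - (euler_error * \<bar>s - t\<bar>)) \<longlongrightarrow> - (euler_error * \<bar>t - t\<bar>)) G"
        by (intro tendsto_intros idG)
      then show "((\<lambda>s. - (euler_error * \<bar>s - t\<bar>)) \<longlongrightarrow> 0) G" by simp
      show "\<forall>\<^sub>F s in G. - (euler_error * \<bar>s - t\<bar>) \<le> (?q s + A (?u t)) \<bullet> (y - ?u t)"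
        using evG
      proof eventually_elim
        case (elim s)
        then have s: "0 \<le> s" "s \<noteq> t" using S by auto
        define d where "d = \<bar>s - t\<bar>"
        have d: "0 < d" using s by (simp add: d_def)
        have "- (euler_error * d) * d \<le> d * ((?q s + A (?u t)) \<bullet> (y - ?u t))"
        proof (cases "t < s")
          case True
          have "d *\<^sub>R (?q s + A (?u t)) = ?u s - ?u t + (s - t) *\<^sub>R A (?u t)"
            using True unfolding scaleR_add_right by (simp add: d_def)
          then show ?thesis
            using evolution_increment[OF x t order_refl less_imp_le[OF True] y] True
            by (simp add: d_def flip: inner_scaleR_left)
        next
          case False
          then have "s < t" using s by simp
          have "d *\<^sub>R (?q s + A (?u t)) = ?u t - ?u s + (t - s) *\<^sub>R A (?u t)"
          proof -
            have "(t - s) *\<^sub>R ?q s = ?u t - ?u s"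
            proof -
              have "(t - s) * (1 / (s - t)) = -1" using \<open>s < t\<close> by (simp add: field_simps)
              then show ?thesis by (simp only: scaleR_scaleR) simp
            qed
            moreover have "d = t - s" using \<open>s < t\<close> by (simp add: d_def)
            ultimately show ?thesis by (simp only: scaleR_add_right)
          qed
          then show ?thesis
            using evolution_increment[OF x s(1) less_imp_le[OF \<open>s < t\<close>] order_refl y] \<open>s < t\<close>
            by (simp add: d_def flip: inner_scaleR_left)
        qed
        then have "d * - (euler_error * d) \<le> d * ((?q s + A (?u t)) \<bullet> (y - ?u t))"
          by (simp only: mult.commute)
        then show ?case using d unfolding d_def by (simp only: mult_le_cancel_left_pos)
      qed
    qed
    then have slope: "- \<xi> \<in> slopes (?u t)" by (simp add: slopes_def add.commute)
    have "norm \<xi> \<le> norm (minimal_slope (?u t))"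
    proof (rule tendsto_le[OF G(2)])
      show "(b \<longlongrightarrow> norm (minimal_slope (?u t))) G" using G(1) lim by (rule tendsto_mono)
      show "((\<lambda>s. norm (?q s)) \<longlongrightarrow> norm \<xi>) G" using q by (rule tendsto_norm)
      show "\<forall>\<^sub>F s in G. norm (?q s) \<le> b s"
        using evG by eventually_elim (use b qnorm in blast)
    qed
    then have "- \<xi> = minimal_slope (?u t)"
      by (intro minimal_slope_unique slope) simp
    then show "\<xi> = - minimal_slope (?u t)" by (metis minus_minus)
  qed
  then show ?thesis by (simp only: has_vector_derivative_iff_quotient)
qed

lemma evolution_right_derivative:
  assumes x: "x \<in> K" and t: "0 \<le> t"
  shows "(evolution x has_vector_derivative - minimal_slope (evolution x t)) (at t within {t..})"
proof (rule evolution_has_derivative[OF x t])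
  show "norm (evolution x s - evolution x t) \<le> norm (minimal_slope (evolution x t)) * \<bar>s - t\<bar>"
    if "s \<in> {t..}" for s
    using evolution_distance[OF x t _ minimal_slope_in_slopes, of s] that by simp
qed (use t in auto)

lemma evolution_eps_solution:
  assumes "x \<in> K"
  shows "eps_solution 0 (evolution x)"
proof -
  have "0 \<le> (- minimal_slope (evolution x t) + A (evolution x t)) \<bullet> (y - evolution x t)"
    if "y \<in> K" for y t
    using minimal_slope_in_slopes[of "evolution x t"] that by (simp add: slopes_def)
  then show ?thesis
    unfolding eps_solution_def
    using evolution_in_K[OF assms] evolution_lipschitz_on[OF assms] evolution_right_derivative[OF assms]
    by (intro conjI exI[of _ M] AE_I2 allI impI exI[of _ "- minimal_slope (evolution x _)"] ballI) simp_all
qed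



lemma evolution_shift_eps_solution:
  assumes x: "x \<in> K" and c: "0 \<le> c"
  shows "eps_solution 0 (\<lambda>t. evolution x (t + c))"
proof -
  have "M-lipschitz_on {0..} (\<lambda>t. evolution x (t + c))"
  proof (rule lipschitz_onI[OF _ M_nonneg])
    fix s t :: real assume "s \<in> {0..}" "t \<in> {0..}"
    then show "dist (evolution x (s + c)) (evolution x (t + c)) \<le> M * dist s t"
      using lipschitz_onD[OF evolution_lipschitz_on[OF x], of "s + c" "t + c"] c by simp
  qed
  moreover have "((\<lambda>t. evolution x (t + c)) has_vector_derivative - minimal_slope (evolution x (t + c)))
      (at t within {t..})" if "0 \<le> t" for t
  proof -
    have "(\<lambda>s. s + c) ` {t..} = {t + c..}" 
      by (auto simp: image_iff intro!: bexI[of _ "_ - c"])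
    moreover have "((\<lambda>s. s + c) has_vector_derivative 1) (at t within {t..})"
      by (auto intro!: derivative_eq_intros)
    ultimately show ?thesis
      using vector_diff_chain_within[of "\<lambda>s. s + c" 1 t "{t..}" "evolution x" "- minimal_slope (evolution x (t + c))"]
        evolution_right_derivative[OF x, of "t + c"] that c
      by (simp add: o_def)
  qed
  moreover have "0 \<le> (- minimal_slope (evolution x (t + c)) + A (evolution x (t + c))) \<bullet> (y - evolution x (t + c))"
    if "y \<in> K" for y t
    using minimal_slope_in_slopes[of "evolution x (t + c)"] that by (simp add: slopes_def)
  ultimately show ?thesis
    unfolding eps_solution_def
    using evolution_in_K[OF x] c
    by (intro conjI exI[of _ M] AE_I2 allI impI exI[of _ "- minimal_slope (evolution x (_ + c))"] ballI) simp_all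
qed

text \<open>
  The evolution started later is again a solution, so by contraction \<open>|u (t + c) - u t|\<close> decreases in
  \<open>t\<close>; dividing by \<open>c\<close> gives the speeds.
\<close>

lemma evolution_speed_antimono:
  assumes x: "x \<in> K" and st: "0 \<le> s" "s \<le> t"
  shows "norm (minimal_slope (evolution x t)) \<le> norm (minimal_slope (evolution x s))"
proof -
  have "norm (- minimal_slope (evolution x t)) \<le> norm (minimal_slope (evolution x s))"
  proof (rule has_vector_derivative_right_norm_le[OF evolution_right_derivative[OF x]])
    show "0 \<le> t" using st by simp
    fix \<tau> assume \<tau>: "t < \<tau>"
    define c where "c = \<tau> - t"
    have c: "0 \<le> c" "t + c = \<tau>" using \<tau> by (auto simp: c_def)
    have "(norm (evolution x (t + c) - evolution x t))\<^sup>2 \<le> (norm (evolution x (s + c) - evolution x s))\<^sup>2"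
      using eps_solution_contraction[OF evolution_shift_eps_solution[OF x c(1)] evolution_eps_solution[OF x] st]
      by simp
    then have "norm (evolution x (t + c) - evolution x t) \<le> norm (evolution x (s + c) - evolution x s)"
      by (rule power2_le_imp_le) simp
    also have "\<dots> \<le> norm (minimal_slope (evolution x s)) * (s + c - s)"
      using c st by (intro evolution_distance x minimal_slope_in_slopes) auto
    finally show "norm (evolution x \<tau> - evolution x t) \<le> norm (minimal_slope (evolution x s)) * (\<tau> - t)"
      using c by (simp add: c_def)
  qed
  then show ?thesis by simp
qed

text \<open>
  A left difference quotient from \<open>s\<close> to \<open>t\<close> is bounded by the speed at the earlier time \<open>s\<close>, which may
  exceed the speed at \<open>t\<close>.  The two agree in the limit where the monotone speed is continuous.
\<close>

lemma evolution_AE_derivative: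
  assumes x: "x \<in> K"
  shows "AE t in lebesgue. 0 \<le> t \<longrightarrow>
    (evolution x has_vector_derivative - minimal_slope (evolution x t)) (at t within {0..})"
proof -
  define m where "m t = norm (minimal_slope (evolution x t))" for t
  have anti: "m t \<le> m s" if "0 \<le> s" "s \<le> t" for s t
    using evolution_speed_antimono[OF x that] by (simp add: m_def)
  define N where "N = {t \<in> {0..}. \<not> continuous (at t within {0..}) (\<lambda>t. - m t)}"
  have "countable N"
    unfolding N_def by (rule mono_on_ctble_discont) (auto simp: mono_on_def anti)
  then have "N \<in> null_sets lebesgue"
    by (intro null_sets_completionI countable_imp_null_set_lborel)
  then show ?thesis
  proof (rule AE_I')
    have "(evolution x has_vector_derivative - minimal_slope (evolution x t)) (at t within {0..})"
      if t: "0 \<le> t" "t \<notin> N" for t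
    proof (rule evolution_has_derivative[OF x t(1) order_refl])
      have "((\<lambda>s. - m s) \<longlongrightarrow> - m t) (at t within {0..})"
        using t by (simp add: N_def continuous_within)
      then have "(m \<longlongrightarrow> m t) (at t within {0..})" by (simp only: tendsto_minus_cancel_left) simp
      then have "((\<lambda>s. max (m s) (m t)) \<longlongrightarrow> max (m t) (m t)) (at t within {0..})"
        by (intro tendsto_intros)
      then show "((\<lambda>s. max (m s) (m t)) \<longlongrightarrow> norm (minimal_slope (evolution x t))) (at t within {0..})"
        by (simp add: m_def)
      fix s :: real assume s: "s \<in> {0..}"
      show "norm (evolution x s - evolution x t) \<le> max (m s) (m t) * \<bar>s - t\<bar>"
      proof (cases "t \<le> s")
        case True
        then have "norm (evolution x s - evolution x t) \<le> m t * \<bar>s - t\<bar>"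
          using evolution_distance[OF x t(1) True minimal_slope_in_slopes] by (simp add: m_def)
        also have "\<dots> \<le> max (m s) (m t) * \<bar>s - t\<bar>" by (intro mult_right_mono) auto
        finally show ?thesis .
      next
        case False
        then have "norm (evolution x t - evolution x s) \<le> m s * \<bar>s - t\<bar>"
          using evolution_distance[OF x _ _ minimal_slope_in_slopes, of s t] s by (simp add: m_def)
        also have "\<dots> \<le> max (m s) (m t) * \<bar>s - t\<bar>" by (intro mult_right_mono) auto
        finally show ?thesis by (simp add: norm_minus_commute)
      qed
    qed
    then show "{t \<in> space lebesgue. \<not> (0 \<le> t \<longrightarrow> (evolution x has_vector_derivative
        - minimal_slope (evolution x t)) (at t within {0..}))} \<subseteq> N" by blast
  qed
qed

section \<open>Convergence of time averages\<close>

definition equilibria :: "'a set" where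
  "equilibria = {p \<in> K. \<forall>y\<in>K. 0 \<le> A p \<bullet> (y - p)}"

lemma equilibrium_eps_solution: "p \<in> equilibria \<Longrightarrow> eps_solution 0 (\<lambda>_. p)"
  unfolding eps_solution_def equilibria_def
  by (intro conjI exI[of _ 0] AE_I2 allI impI) (auto simp: lipschitz_on_def)

text \<open>
  Test with points of the segment from \<open>p\<close> to \<open>y\<close> and let them approach \<open>p\<close>; continuity of \<open>A\<close> moves its
  argument to \<open>p\<close>.
\<close>

lemma Minty_equilibrium:
  assumes p: "p \<in> K" and minty: "\<And>y. y \<in> K \<Longrightarrow> 0 \<le> A y \<bullet> (y - p)"
  shows "p \<in> equilibria"
proof -
  have "0 \<le> A p \<bullet> (y - p)" if y: "y \<in> K" for y
  proof (rule LIMSEQ_le_const)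
    define z where "z k = p + (1 / real (Suc k)) *\<^sub>R (y - p)" for k
    have zK: "z k \<in> K" for k
    proof -
      have "z k = (1 - 1 / real (Suc k)) *\<^sub>R p + (1 / real (Suc k)) *\<^sub>R y"
        by (simp add: z_def algebra_simps)
      then show ?thesis using convexD_alt[OF convex_K p y, of "1 / real (Suc k)"] by simp
    qed
    have "(\<lambda>k. 1 / real (Suc k)) \<longlonglongrightarrow> 0"
      using LIMSEQ_inverse_real_of_nat by (simp add: inverse_eq_divide)
    then have "z \<longlonglongrightarrow> p + 0 *\<^sub>R (y - p)"
      unfolding z_def by (intro tendsto_intros)
    then have "z \<longlonglongrightarrow> p" by simp
    then have "(\<lambda>k. A (z k)) \<longlonglongrightarrow> A p"
      by (rule continuous_on_tendsto_compose[OF lipschitz_on_continuous_on[OF A_lipschitz] _ p])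
        (simp add: zK)
    then show "(\<lambda>k. A (z k) \<bullet> (y - p)) \<longlonglongrightarrow> A p \<bullet> (y - p)"
      by (intro tendsto_intros)
    have "0 \<le> A (z k) \<bullet> (y - p)" for k
      using minty[OF zK[of k]] by (simp add: z_def zero_le_divide_iff)
    then show "\<exists>N. \<forall>k\<ge>N. 0 \<le> A (z k) \<bullet> (y - p)" by blast
  qed
  then show ?thesis using p by (simp add: equilibria_def)
qed

text \<open>
  By monotonicity \<open>u' \<bullet> (u - y) \<le> A u \<bullet> (y - u) \<le> A y \<bullet> (y - u)\<close>.  The last expression is affine in
  \<open>u\<close>, so its integral only involves the integral of \<open>u\<close>.
\<close>

lemma solution_energy_inequality:
  assumes u: "eps_solution 0 u" and y: "y \<in> K" and t: "0 \<le> t"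
  shows "(norm (u t - y))\<^sup>2 - (norm (u 0 - y))\<^sup>2 \<le> 2 * (A y \<bullet> (t *\<^sub>R y - integral {0..t} u))"
proof -
  obtain L where L: "L-lipschitz_on {0..} u" using u unfolding eps_solution_def by blast
  have K: "u \<tau> \<in> K" if "0 \<le> \<tau>" for \<tau> using u that unfolding eps_solution_def by blast
  have cont: "continuous_on {0..t} u"
    using lipschitz_on_continuous_on[OF L] by (rule continuous_on_subset) auto
  define G where "G \<tau> = (\<tau> *\<^sub>R y - integral {0..\<tau>} u) \<bullet> A y" for \<tau>
  have G: "(G has_real_derivative (y - u \<tau>) \<bullet> A y) (at \<tau> within {0..t})" if "\<tau> \<in> {0..t}" for \<tau>
    unfolding G_def
    using integral_has_vector_derivative[OF cont that]
    by (intro has_real_derivative_inner_const has_vector_derivative_diff)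
      (auto intro!: derivative_eq_intros)
  have Glip: "(M * D)-lipschitz_on {0..t} G"
  proof (rule lipschitz_onI)
    fix p q assume pq: "p \<in> {0..t}" "q \<in> {0..t}"
    show "dist (G p) (G q) \<le> M * D * dist p q"
      unfolding dist_norm
    proof (rule field_differentiable_bound[OF convex_closed_interval G _ pq])
      fix \<tau> assume "\<tau> \<in> {0..t}"
      then have "norm (y - u \<tau>) \<le> D" using norm_diff_le_D[OF y K] by simp
      then have "norm (y - u \<tau>) * norm (A y) \<le> D * M"
        using norm_A_le[OF y] D_nonneg by (intro mult_mono) auto
      then show "norm ((y - u \<tau>) \<bullet> A y) \<le> M * D"
        using Cauchy_Schwarz_ineq2[of "y - u \<tau>" "A y"] by (simp add: mult.commute)
    qed
  qed (simp add: M_nonneg D_nonneg)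
  define g where "g \<tau> = (u \<tau> - y) \<bullet> (u \<tau> - y) - 2 * G \<tau>" for \<tau>
  have "g t - g 0 \<le> 0 * (t - 0)"
  proof (rule lipschitz_right_derivative_bound[OF _ t])
    have "(2 * D * (L + 0))-lipschitz_on {0..t} (\<lambda>\<tau>. (u \<tau> - y) \<bullet> (u \<tau> - y))"
      using L y by (intro inner_self_lipschitz_on lipschitz_on_diff lipschitz_on_constant norm_diff_le_D K D_nonneg)
        (auto intro: lipschitz_on_subset)
    moreover have "(2 * (M * D))-lipschitz_on {0..t} (\<lambda>\<tau>. 2 * G \<tau>)"
      using lipschitz_on_cmult_real[OF Glip, of 2] by simp
    ultimately show "(2 * D * (L + 0) + 2 * (M * D))-lipschitz_on {0..t} g"
      unfolding g_def by (rule lipschitz_on_diff)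
    have "AE \<tau> in lebesgue. 0 \<le> \<tau> \<longrightarrow>
        (\<exists>w. (u has_vector_derivative w) (at \<tau> within {\<tau>..}) \<and>
             (\<forall>y\<in>K. - 0 \<le> (w + A (u \<tau>)) \<bullet> (y - u \<tau>)))"
      using u unfolding eps_solution_def by blast
    then show "AE \<tau> in lebesgue. 0 \<le> \<tau> \<and> \<tau> < t \<longrightarrow>
       (\<exists>d\<le>0. (g has_real_derivative d) (at \<tau> within {\<tau>..}))"
    proof eventually_elim
      case (elim \<tau>)
      show ?case
      proof safe
        assume \<tau>: "0 \<le> \<tau>" "\<tau> < t"
        then obtain v where v: "(u has_vector_derivative v) (at \<tau> within {\<tau>..})"
            "0 \<le> (v + A (u \<tau>)) \<bullet> (y - u \<tau>)"
          using elim y by auto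
        have "(G has_real_derivative (y - u \<tau>) \<bullet> A y) (at \<tau> within {\<tau>..t})"
          using \<tau> by (intro has_field_derivative_subset[OF G]) auto
        then have "(G has_real_derivative (y - u \<tau>) \<bullet> A y) (at \<tau> within {\<tau>..})"
          using \<tau> by (simp add: at_within_Icc_at_right at_within_Ici_at_right)
        moreover have "((\<lambda>\<tau>. (u \<tau> - y) \<bullet> (u \<tau> - y)) has_real_derivative 2 * ((v - 0) \<bullet> (u \<tau> - y)))
            (at \<tau> within {\<tau>..})"
          by (intro has_real_derivative_inner_self has_vector_derivative_diff v has_vector_derivative_const)
        ultimately have "(g has_real_derivative 2 * ((v - 0) \<bullet> (u \<tau> - y)) - 2 * ((y - u \<tau>) \<bullet> A y)) (at \<tau> within {\<tau>..})"
          unfolding g_def by (intro DERIV_diff DERIV_cmult)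
        moreover have "2 * ((v - 0) \<bullet> (u \<tau> - y)) - 2 * ((y - u \<tau>) \<bullet> A y) \<le> 0"
          using v(2) A_mono[OF K[OF \<tau>(1)] y]
          by (simp add: inner_diff_left inner_diff_right inner_add_left inner_add_right inner_commute)
        ultimately show "\<exists>d\<le>0. (g has_real_derivative d) (at \<tau> within {\<tau>..})" by blast
      qed
    qed
  qed
  then show ?thesis by (simp add: g_def G_def power2_norm_eq_inner inner_commute)
qed

lemma solution_average_in_K:
  assumes u: "eps_solution 0 u" and t: "0 < t"
  shows "(1 / t) *\<^sub>R integral {0..t} u \<in> K"
proof (rule ccontr)
  let ?\<sigma> = "(1 / t) *\<^sub>R integral {0..t} u"
  assume "?\<sigma> \<notin> K"
  then obtain a b where ab: "a \<bullet> ?\<sigma> < b" "\<And>x. x \<in> K \<Longrightarrow> b < a \<bullet> x"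
    using separating_hyperplane_closed_point[OF convex_K closed_K] by blast
  obtain L where "L-lipschitz_on {0..} u" using u unfolding eps_solution_def by blast
  then have int: "u integrable_on {0..t}"
    by (intro integrable_continuous_real continuous_on_subset[OF lipschitz_on_continuous_on]) auto
  have ia: "((\<lambda>s. a \<bullet> u s) has_integral a \<bullet> integral {0..t} u) {0..t}"
    using has_integral_linear[OF integrable_integral[OF int] bounded_linear_inner_right[of a]]
    by (simp add: o_def)
  have ib: "((\<lambda>s. b) has_integral t * b) {0..t}"
    using has_integral_const_real[of b 0 t] t by simp
  have "t * b \<le> a \<bullet> integral {0..t} u"
  proof (rule has_integral_le[OF ib ia])
    show "b \<le> a \<bullet> u s" if "s \<in> {0..t}" for s
      using ab(2)[of "u s"] u that unfolding eps_solution_def by force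
  qed
  then show False using ab(1) t by (simp add: pos_divide_less_eq mult.commute)
qed

text \<open>
  Dividing the energy inequality by \<open>t\<close> shows that cluster points of the averages are equilibria.  For
  two of them, \<open>p\<close> and \<open>e\<close>, the distances from \<open>u\<close> to both converge, hence so does \<open>u \<bullet> (e - p)\<close>, and with it
  the average of this quantity; evaluating its limit along the two filters gives
  \<open>p \<bullet> (e - p) = e \<bullet> (e - p)\<close>.
\<close>

theorem solution_average_tendsto_equilibrium:
  assumes u: "eps_solution 0 u"
  shows "\<exists>p\<in>equilibria. ((\<lambda>t. (1 / t) *\<^sub>R integral {0..t} u) \<longlongrightarrow> p) at_top"
proof -
  let ?\<sigma> = "\<lambda>t. (1 / t) *\<^sub>R integral {0..t} u"
  obtain L where L: "L-lipschitz_on {0..} u" using u unfolding eps_solution_def by blast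
  have cont: "continuous_on {0..} u" using L by (rule lipschitz_on_continuous_on)
  have ev: "\<forall>\<^sub>F t in at_top. ?\<sigma> t \<in> K"
    using eventually_gt_at_top[of 0] by eventually_elim (rule solution_average_in_K[OF u])
  have cluster: "p \<in> equilibria"
    if G: "G \<le> at_top" "G \<noteq> bot" and p: "p \<in> K" "(?\<sigma> \<longlongrightarrow> p) G" for G p
  proof (rule Minty_equilibrium[OF p(1)])
    fix y assume y: "y \<in> K"
    show "0 \<le> A y \<bullet> (y - p)"
    proof (rule tendsto_le[OF G(2)])
      show "((\<lambda>t. A y \<bullet> (y - ?\<sigma> t)) \<longlongrightarrow> A y \<bullet> (y - p)) G"
        by (intro tendsto_intros p)
      have "((\<lambda>t::real. - (norm (u 0 - y))\<^sup>2 / 2 * inverse t) \<longlongrightarrow> - (norm (u 0 - y))\<^sup>2 / 2 * 0) at_top"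
        by (intro tendsto_intros tendsto_inverse_0_at_top filterlim_ident)
      then show "((\<lambda>t::real. - (norm (u 0 - y))\<^sup>2 / 2 * inverse t) \<longlongrightarrow> 0) G"
        using G(1) by (intro tendsto_mono[OF G(1)]) simp
      have "\<forall>\<^sub>F t in at_top. - (norm (u 0 - y))\<^sup>2 / 2 * inverse t \<le> A y \<bullet> (y - ?\<sigma> t)"
        using eventually_gt_at_top[of 0]
      proof eventually_elim
        case (elim t)
        have "t *\<^sub>R y - integral {0..t} u = t *\<^sub>R (y - ?\<sigma> t)"
          using elim by (simp add: scaleR_diff_right)
        then have "- (norm (u 0 - y))\<^sup>2 \<le> 2 * (t * (A y \<bullet> (y - ?\<sigma> t)))"
          using solution_energy_inequality[OF u y, of t] elim
            zero_le_power2[of "norm (u t - y)"] by (simp only: inner_scaleR_right) linarith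
        then show ?case using elim by (simp add: field_simps)
      qed
      then show "\<forall>\<^sub>F t in G. - (norm (u 0 - y))\<^sup>2 / 2 * inverse t \<le> A y \<bullet> (y - ?\<sigma> t)"
        using G(1) by (rule filter_leD[rotated])
    qed
  qed
  obtain G p where p: "G \<le> at_top" "G \<noteq> bot" "p \<in> K" "(?\<sigma> \<longlongrightarrow> p) G"
    using compact_cluster_filter[OF compact_K ev] by auto
  have pE: "p \<in> equilibria" using cluster p by blast
  have dist_lim: "\<exists>l. ((\<lambda>t. (norm (u t - e))\<^sup>2) \<longlongrightarrow> l) at_top" if "e \<in> equilibria" for e
    using eps_solution_contraction[OF u equilibrium_eps_solution[OF that]]
    by (intro antimono_bounded_below_convergent_at_top[where c = 0]) auto
  have "(?\<sigma> \<longlongrightarrow> p) at_top"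
  proof (rule tendsto_unique_cluster_point[OF compact_K ev])
    fix H e assume e: "H \<le> at_top" "H \<noteq> bot" "e \<in> K" "(?\<sigma> \<longlongrightarrow> e) H"
    then have eE: "e \<in> equilibria" using cluster by blast
    obtain l l' where "((\<lambda>t. (norm (u t - p))\<^sup>2) \<longlongrightarrow> l) at_top" "((\<lambda>t. (norm (u t - e))\<^sup>2) \<longlongrightarrow> l') at_top"
      using dist_lim[OF pE] dist_lim[OF eE] by blast
    then have "((\<lambda>t. ((norm (u t - p))\<^sup>2 - (norm (u t - e))\<^sup>2 - (p \<bullet> p - e \<bullet> e)) / 2)
        \<longlongrightarrow> (l - l' - (p \<bullet> p - e \<bullet> e)) / 2) at_top"
      by (intro tendsto_intros) auto
    moreover have "((norm (u t - p))\<^sup>2 - (norm (u t - e))\<^sup>2 - (p \<bullet> p - e \<bullet> e)) / 2 = u t \<bullet> (e - p)" for t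
      by (simp add: power2_norm_eq_inner inner_diff_left inner_diff_right inner_commute)
    ultimately obtain c where c: "((\<lambda>t. u t \<bullet> (e - p)) \<longlongrightarrow> c) at_top" by auto
    have "((\<lambda>t. (1 / t) * integral {0..t} (\<lambda>t. u t \<bullet> (e - p))) \<longlongrightarrow> c) at_top"
      by (intro tendsto_average[OF _ c] continuous_intros cont)
    moreover have "integral {0..t} (\<lambda>t. u t \<bullet> (e - p)) = integral {0..t} u \<bullet> (e - p)" for t
    proof -
      have "u integrable_on {0..t}"
        by (intro integrable_continuous_real continuous_on_subset[OF cont]) auto
      then show ?thesis
        using integral_linear[OF _ bounded_linear_inner_left[of "e - p"]] by (simp add: o_def)
    qed
    ultimately have "((\<lambda>t. ?\<sigma> t \<bullet> (e - p)) \<longlongrightarrow> c) at_top" by simp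
    then have cG: "((\<lambda>t. ?\<sigma> t \<bullet> (e - p)) \<longlongrightarrow> c) G" "((\<lambda>t. ?\<sigma> t \<bullet> (e - p)) \<longlongrightarrow> c) H"
      using p(1) e(1) by (auto intro: tendsto_mono)
    have "p \<bullet> (e - p) = c"
      by (rule tendsto_unique[OF p(2) _ cG(1)]) (intro tendsto_intros p)
    moreover have "e \<bullet> (e - p) = c"
      by (rule tendsto_unique[OF e(2) _ cG(2)]) (intro tendsto_intros e)
    ultimately have "(e - p) \<bullet> (e - p) = 0" by (simp only: inner_diff_left)
    then show "e = p" by simp
  qed
  then show ?thesis using pE by blast
qed

end

section \<open>Lipschitz continuity from the exchange inequality\<close>

definition mix_coordinates :: "'n set \<Rightarrow> (real ^ 'd) ^ 'n \<Rightarrow> (real ^ 'd) ^ 'n \<Rightarrow> (real ^ 'd) ^ 'n" where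
  "mix_coordinates S x y = (\<chi> i. if i \<in> S then x $ i else y $ i)"

definition toggle :: "'n \<Rightarrow> 'n set \<Rightarrow> 'n set" where
  "toggle j S = (if j \<in> S then S - {j} else insert j S)"

lemma sum_toggle:
  fixes G :: "'n::finite set \<Rightarrow> 'b::comm_monoid_add"
  shows "(\<Sum>S\<in>UNIV. G (toggle j S)) = (\<Sum>S\<in>UNIV. G S)"
proof (rule sum.reindex_bij_betw)
  have "toggle j (toggle j S) = S" for S by (auto simp: toggle_def)
  then show "bij (toggle j)" by (rule involuntory_imp_bij)
qed

text \<open>
  For each set \<open>S\<close> of coordinates, apply the inequality to the points obtained from \<open>x\<close> and \<open>y\<close> by
  swapping the coordinates outside \<open>S\<close>.  Replacing coordinate \<open>j\<close> amounts to toggling \<open>j\<close> in \<open>S\<close>, which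
  permutes the sets, so the gaps of these inequalities add up to \<open>0\<close>.  Being nonnegative, they all vanish.
\<close>

lemma exchange_inequality_imp_equality:
  fixes X :: "'n::finite \<Rightarrow> (real ^ 'd) set"
  assumes ineq: "\<And>x y. x \<in> vprod X \<Longrightarrow> y \<in> vprod X \<Longrightarrow>
           (\<Sum>j\<in>UNIV. f j x + f j y) \<ge>
           (\<Sum>j\<in>UNIV. f j (replace x j (y $ j)) + f j (replace y j (x $ j)))"
    and x: "x \<in> vprod X" and y: "y \<in> vprod X"
  shows "(\<Sum>j\<in>UNIV. f j (replace x j (y $ j)) + f j (replace y j (x $ j)))
       = (\<Sum>j\<in>UNIV. f j x + f j y :: real)"
proof -
  define G where "G j S = f j (mix_coordinates S x y) + f j (mix_coordinates (- S) x y)" for j S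
  define gap where "gap S = (\<Sum>j\<in>UNIV. G j S) - (\<Sum>j\<in>UNIV. G j (toggle j S))" for S
  have rep: "f j (replace (mix_coordinates S x y) j (mix_coordinates (- S) x y $ j))
      + f j (replace (mix_coordinates (- S) x y) j (mix_coordinates S x y $ j)) = G j (toggle j S)" for j S
  proof -
    have "replace (mix_coordinates S x y) j (mix_coordinates (- S) x y $ j) = mix_coordinates (toggle j S) x y"
      "replace (mix_coordinates (- S) x y) j (mix_coordinates S x y $ j) = mix_coordinates (- toggle j S) x y"
      by (auto simp: vec_eq_iff replace_def mix_coordinates_def toggle_def)
    then show ?thesis by (simp add: G_def)
  qed
  have nonneg: "0 \<le> gap S" for S
  proof -
    have "mix_coordinates S x y \<in> vprod X" "mix_coordinates (- S) x y \<in> vprod X"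
      using x y by (auto simp: vprod_def mix_coordinates_def)
    from ineq[OF this] show ?thesis unfolding rep by (simp add: gap_def G_def)
  qed
  have swap: "(\<Sum>S\<in>UNIV. \<Sum>j\<in>UNIV. H j S) = (\<Sum>j\<in>UNIV. \<Sum>S\<in>UNIV. H j S)"
    for H :: "'n \<Rightarrow> 'n set \<Rightarrow> real" by (rule sum.swap)
  have "(\<Sum>S\<in>UNIV. gap S) = (\<Sum>j\<in>UNIV. (\<Sum>S\<in>UNIV. G j S) - (\<Sum>S\<in>UNIV. G j (toggle j S)))"
    unfolding gap_def sum_subtractf swap[of G] swap[of "\<lambda>j S. G j (toggle j S)"] ..
  also have "\<dots> = 0" by (simp add: sum_toggle)
  finally have "gap UNIV = 0"
    using nonneg by (simp add: sum_nonneg_eq_0_iff)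
  moreover have ex: "mix_coordinates UNIV x y = x" "mix_coordinates (- UNIV) x y = y"
    by (simp_all add: mix_coordinates_def vec_eq_iff)
  moreover have "f j (replace x j (y $ j)) + f j (replace y j (x $ j)) = G j (toggle j UNIV)" for j
    using rep[of j UNIV] by (simp only: ex)
  moreover have "G j UNIV = f j x + f j y" for j
    by (simp only: G_def ex)
  ultimately show ?thesis by (simp only: gap_def)
qed

text \<open>
  Polarising the hypothesis gives \<open>(A x - A y) \<bullet> (z - c) = - (A z - A c) \<bullet> (x - y)\<close>: the
  increment of \<open>A\<close> between \<open>x\<close> and \<open>y\<close>, seen along \<open>z - c\<close>, is linear in \<open>x - y\<close>.  Finitely
  many directions \<open>z - c = r b\<close> with \<open>b\<close> in the basis suffice.
\<close>

lemma skew_map_lipschitz: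
  fixes A :: "'a::euclidean_space \<Rightarrow> 'a"
  assumes r: "0 < r" "cball c r \<subseteq> K"
    and skew: "\<And>x y. x \<in> K \<Longrightarrow> y \<in> K \<Longrightarrow> (A x - A y) \<bullet> (x - y) = 0"
  shows "\<exists>L. L-lipschitz_on K A"
proof
  define B where "B b = norm (A (c + r *\<^sub>R b) - A c) / r" for b
  show "(\<Sum>b\<in>Basis. B b)-lipschitz_on K A"
  proof (rule lipschitz_onI)
    fix x y assume xy: "x \<in> K" "y \<in> K"
    have "\<bar>(A x - A y) \<bullet> b\<bar> \<le> B b * norm (x - y)" if "b \<in> Basis" for b
    proof -
      let ?z = "c + r *\<^sub>R b"
      have z: "?z \<in> K" "c \<in> K" using r that by (auto simp: dist_norm)
      have "(A x - A y) \<bullet> (?z - c) = - ((A ?z - A c) \<bullet> (x - y))"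
        using skew[OF xy(1) z(1)] skew[OF xy(1) z(2)] skew[OF xy(2) z(1)] skew[OF xy(2) z(2)]
        by (simp only: inner_diff_left inner_diff_right)
      then have "r * \<bar>(A x - A y) \<bullet> b\<bar> \<le> norm (A ?z - A c) * norm (x - y)"
        using Cauchy_Schwarz_ineq2[of "A ?z - A c" "x - y"] r by (simp add: abs_mult)
      then show ?thesis using r by (simp add: B_def field_simps)
    qed
    then have "(\<Sum>b\<in>Basis. \<bar>(A x - A y) \<bullet> b\<bar>) \<le> (\<Sum>b\<in>Basis. B b) * norm (x - y)"
      unfolding sum_distrib_right by (rule sum_mono)
    then show "dist (A x) (A y) \<le> (\<Sum>b\<in>Basis. B b) * dist x y"
      using norm_le_l1[of "A x - A y"] by (simp add: dist_norm)
  qed (use r in \<open>auto simp: B_def intro!: sum_nonneg\<close>)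
qed

section \<open>The product of strategy sets and the evolution of the game\<close>

lemma convex_vprod: "(\<And>j. convex (X j)) \<Longrightarrow> convex (vprod X)"
  by (auto simp: vprod_def convex_def)

lemma compact_vprod:
  fixes X :: "'n::finite \<Rightarrow> (real ^ 'd::finite) set"
  assumes "\<And>j. compact (X j)"
  shows "compact (vprod X)"
proof -
  have "closed (vprod X)"
  proof -
    have "vprod X = (\<Inter>j. (\<lambda>x. x $ j) -` X j)" by (auto simp: vprod_def)
    moreover have "closed ((\<lambda>x. x $ j) -` X j)" for j
      by (intro closed_vimage compact_imp_closed assms continuous_intros)
    ultimately show ?thesis by (simp add: closed_INT)
  qed
  moreover have "bounded (vprod X)"
  proof -
    obtain B where B: "\<And>j z. z \<in> X j \<Longrightarrow> norm z \<le> B j"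
      using compact_imp_bounded[OF assms] unfolding bounded_iff by metis
    have "norm x \<le> (\<Sum>j\<in>UNIV. B j)" if "x \<in> vprod X" for x
    proof -
      have "norm x \<le> (\<Sum>j\<in>UNIV. norm (x $ j))"
        unfolding norm_vec_def by (rule L2_set_le_sum) simp
      also have "\<dots> \<le> (\<Sum>j\<in>UNIV. B j)" using that B by (intro sum_mono) (simp add: vprod_def)
      finally show ?thesis .
    qed
    then show ?thesis unfolding bounded_iff by blast
  qed
  ultimately show ?thesis by (simp add: compact_eq_bounded_closed)
qed

lemma cball_subset_vprod:
  fixes X :: "'n::finite \<Rightarrow> (real ^ 'd::finite) set"
  assumes "\<And>j. interior (X j) \<noteq> {}"
  obtains c r where "0 < r" "cball c r \<subseteq> vprod X"
proof -
  have "\<exists>a e. 0 < e \<and> cball a e \<subseteq> X j" for j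
    using assms[of j] by (metis all_not_in_conv mem_interior_cball)
  then obtain a e where ae: "\<And>j. 0 < e j" "\<And>j. cball (a j) (e j) \<subseteq> X j" by metis
  define r where "r = Min (range e)"
  have "0 < r" using ae by (simp add: r_def)
  moreover have "cball (\<chi> j. a j) r \<subseteq> vprod X"
  proof
    fix x assume x: "x \<in> cball (\<chi> j. a j) r"
    have "x $ j \<in> X j" for j
    proof -
      have "dist (a j) (x $ j) \<le> r"
        using dist_vec_nth_le[of "\<chi> j. a j" j x] x by simp
      also have "r \<le> e j" by (simp add: r_def)
      finally show ?thesis using ae(2)[of j] by auto
    qed
    then show "x \<in> vprod X" by (simp add: vprod_def)
  qed
  ultimately show thesis using that by blast
qed

definition gradient_field ::
    "('n \<Rightarrow> (real ^ 'd) set) \<Rightarrow> ('n \<Rightarrow> (real ^ 'd) ^ 'n \<Rightarrow> real) \<Rightarrow> (real ^ 'd) ^ 'n \<Rightarrow> (real ^ 'd) ^ 'n" where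
  "gradient_field X f x = (\<chi> j. partial_gradient X f j x)"

lemma replace_self: "replace x j (x $ j) = x"
  by (simp add: replace_def vec_eq_iff)

theorem proposition3p3:
  fixes X :: "'n::finite \<Rightarrow> (real ^ 'd::finite) set"
    and f :: "'n \<Rightarrow> (real ^ 'd) ^ 'n \<Rightarrow> real"
    and u0 :: "(real ^ 'd) ^ 'n"
  assumes "\<And>j. convex (X j)" and "\<And>j. compact (X j)" and "\<And>j. interior (X j) \<noteq> {}"
    and "N_linear X f"
    and "\<And>x y. x \<in> vprod X \<Longrightarrow> y \<in> vprod X \<Longrightarrow>
           (\<Sum>j\<in>UNIV. f j x + f j y) \<ge>
           (\<Sum>j\<in>UNIV. f j (replace x j (y $ j)) + f j (replace y j (x $ j)))"
    and "u0 \<in> vprod X"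
  shows "\<exists>u. lipschitz_solution X f u0 u \<and>
           (\<forall>v. lipschitz_solution X f u0 v \<longrightarrow> (\<forall>t\<ge>0. v t = u t)) \<and>
           (\<exists>x. nash_equilibrium X f x \<and>
                ((\<lambda>t. (1 / t) *\<^sub>R integral {0..t} u) \<longlongrightarrow> x) at_top)"
proof -
  let ?A = "gradient_field X f"
  have grad: "?A x \<bullet> y = (\<Sum>j\<in>UNIV. f j (replace x j (y $ j)))" if "x \<in> vprod X" "y \<in> vprod X" for x y
  proof -
    have "partial_gradient X f j x \<bullet> y $ j = f j (replace x j (y $ j))" for j
      using partial_gradient_inner[OF assms(1,3,4) that(1), of "y $ j" j] that(2)
      by (simp add: vprod_def inner_commute)
    then show ?thesis by (simp add: gradient_field_def inner_vec_def)
  qed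
  have skew: "(?A x - ?A y) \<bullet> (x - y) = 0" if x: "x \<in> vprod X" and y: "y \<in> vprod X" for x y
    using exchange_inequality_imp_equality[of X f, OF assms(5) x y]
    by (simp add: inner_diff_left inner_diff_right grad x y replace_self sum.distrib)
  obtain c r where cr: "0 < r" "cball c r \<subseteq> vprod X"
    by (rule cball_subset_vprod[OF assms(3)])
  obtain \<Lambda> where \<Lambda>: "\<Lambda>-lipschitz_on (vprod X) ?A"
    using skew_map_lipschitz[OF cr skew] by auto
  interpret monotone_inequality "vprod X" ?A \<Lambda>
  proof
    show "compact (vprod X)" by (rule compact_vprod[OF assms(2)])
    show "convex (vprod X)" by (rule convex_vprod[OF assms(1)])
    show "0 \<le> (?A x - ?A y) \<bullet> (x - y)" if "x \<in> vprod X" "y \<in> vprod X" for x y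
      using skew[OF that] by simp
  qed (rule \<Lambda>)
  have sum_eq: "(\<Sum>j\<in>UNIV. (v $ j + partial_gradient X f j x) \<bullet> (y $ j - x $ j)) = (v + ?A x) \<bullet> (y - x)"
    for v x y
    by (simp add: inner_vec_def gradient_field_def)
  let ?u = "evolution u0"
  have eps: "eps_solution 0 ?u" by (rule evolution_eps_solution[OF assms(6)])
  have sol: "lipschitz_solution X f u0 ?u"
    unfolding lipschitz_solution_def sum_eq
  proof (intro conjI allI impI)
    show "?u t \<in> vprod X" if "0 \<le> t" for t by (rule evolution_in_K[OF assms(6) that])
    show "\<exists>L. L-lipschitz_on {0..} ?u" using evolution_lipschitz_on[OF assms(6)] by blast
    show "?u 0 = u0" by (rule evolution_0[OF assms(6)])
    show "AE t in lebesgue. 0 \<le> t \<longrightarrow> (\<exists>v. (?u has_vector_derivative v) (at t within {0..}) \<and>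
        (\<forall>y\<in>vprod X. 0 \<le> (v + ?A (?u t)) \<bullet> (y - ?u t)))"
      using evolution_AE_derivative[OF assms(6)]
    proof eventually_elim
      case (elim t)
      moreover have "0 \<le> (- minimal_slope (?u t) + ?A (?u t)) \<bullet> (y - ?u t)" if "y \<in> vprod X" for y
        using minimal_slope_in_slopes[of "?u t"] that by (simp add: slopes_def)
      ultimately show ?case by blast
    qed
  qed
  have uniq: "v t = ?u t" if v: "lipschitz_solution X f u0 v" and t: "0 \<le> t" for v t
  proof -
    have v': "(\<forall>t\<ge>0. v t \<in> vprod X)" "(\<exists>L. L-lipschitz_on {0..} v)" "v 0 = u0"
      and der: "AE t in lebesgue. 0 \<le> t \<longrightarrow> (\<exists>w. (v has_vector_derivative w) (at t within {0..}) \<and>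
        (\<forall>y\<in>vprod X. 0 \<le> (w + ?A (v t)) \<bullet> (y - v t)))"
      using v unfolding lipschitz_solution_def sum_eq by blast+
    have "AE t in lebesgue. 0 \<le> t \<longrightarrow> (\<exists>w. (v has_vector_derivative w) (at t within {t..}) \<and>
        (\<forall>y\<in>vprod X. - 0 \<le> (w + ?A (v t)) \<bullet> (y - v t)))"
      using der
    proof eventually_elim
      case (elim t)
      have "(v has_vector_derivative w) (at t within {t..})"
        if "(v has_vector_derivative w) (at t within {0..})" "0 \<le> t" for w
        using that by (auto intro: has_vector_derivative_within_subset)
      with elim show ?case by auto
    qed
    then have "eps_solution 0 v" using v' unfolding eps_solution_def by blast
    from eps_solution_contraction[OF this eps order_refl t]
    show ?thesis by (simp add: v'(3) evolution_0[OF assms(6)])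
  qed
  have nash: "nash_equilibrium X f p" if p: "p \<in> equilibria" for p
    unfolding nash_equilibrium_def
  proof (intro conjI allI ballI)
    show pX: "p \<in> vprod X" using p by (simp add: equilibria_def)
    \<comment> \<open>Deviations of a single player suffice as test points.\<close>
    fix j z assume z: "z \<in> X j"
    have y: "replace p j z \<in> vprod X" using pX z by (simp add: vprod_def replace_def)
    have "?A p \<bullet> (replace p j z - p) = partial_gradient X f j p \<bullet> (z - p $ j)"
    proof -
      have "?A p \<bullet> (replace p j z - p)
          = (\<Sum>i\<in>UNIV. if i = j then partial_gradient X f j p \<bullet> (z - p $ j) else 0)"
        unfolding inner_vec_def by (intro sum.cong) (auto simp: gradient_field_def replace_def)
      then show ?thesis by simp
    qed
    also have "\<dots> = f j (replace p j z) - f j p"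
      using partial_gradient_inner[OF assms(1,3,4) pX z]
        partial_gradient_inner[OF assms(1,3,4) pX, of "p $ j" j] pX
      by (simp add: vprod_def inner_diff_right inner_commute replace_self)
    finally show "f j p \<le> f j (replace p j z)"
      using p y unfolding equilibria_def by force
  qed
  obtain p where "p \<in> equilibria" "((\<lambda>t. (1 / t) *\<^sub>R integral {0..t} ?u) \<longlongrightarrow> p) at_top"
    using solution_average_tendsto_equilibrium[OF eps] by blast
  then show ?thesis using sol uniq nash by blast
qed

end
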